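(* Let $k\ge 0$ and let $f:\mathbb{D}\to\mathbb{D}$ be holomorphic and not a Blaschke product of degree at most $k$. Let $\sigma\in\partial\mathbb{D}$ with $\beta_f(\sigma)<+\infty$. Then $$\beta_f(\sigma)\ge\sum_{j=0}^k\frac{1-|w_{j+1}|^2}{|\sigma-w_{j+1}|^2}\prod_{h=0}^j\frac{|\Delta_{w_h,\ldots,w_1}f(\sigma)-\Delta_{w_h,\ldots,w_1}f(w_{h+1})|^2}{1-|\Delta_{w_h,\ldots,w_1}f(w_{h+1})|^2}$$ for every $w_1,\ldots,w_{k+1}\in\mathbb{D}$, where $\Delta_{w_h,\ldots,w_1}f=f$ when $h=0$. Furthermore, equality holds for some $w_1,\ldots,w_{k+1}\in\mathbb{D}$ if and only if it holds for all $w_1,\ldots,w_{k+1}\in\mathbb{D}$, if and only if $f$ is a Blaschke product of degree $k+1$.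
   Context: $\mathbb{D}=\{z\in\mathbb{C}:|z|<1\}$ and $\partial\mathbb{D}$ is the unit circle. For a holomorphic $g:\mathbb{D}\to\mathbb{D}$ and $\sigma\in\partial\mathbb{D}$, the boundary dilation coefficient is $\beta_g(\sigma)=\liminf_{z\to\sigma}\frac{1-|g(z)|}{1-|z|}$. A Blaschke product of degree $d\ge 1$ is a function $B(z)=e^{i\theta}\prod_{j=1}^d\frac{z-a_j}{1-\overline{a_j}z}$ with $\theta\in\mathbb{R}$, $a_1,\ldots,a_d\in\mathbb{D}$; those of degree $0$ are the constants of modulus $1$. For $g:\mathbb{D}\to\mathbb{D}$ holomorphic and $w\in\mathbb{D}$, the hyperbolic difference quotient is the holomorphic function $\Delta_w g(z)=g^*(z,w)$, where $g^*(z,w)=\frac{g(z)-g(w)}{1-\overline{g(w)}g(z)}\big/\frac{z-w}{1-\overline{w}z}$ for $z\ne w$ and $g^*(w,w)=g'(w)\frac{1-|w|^2}{1-|g(w)|^2}$. Inductively, $\Delta_{w_h,\ldots,w_1}f=\Delta_{w_h}(\Delta_{w_{h-1},\ldots,w_1}f)$. If $f$ is not a Blaschke product of degree at most $k$, then for $0\le h\le k$ the function $\Delta_{w_h,\ldots,w_1}f$ is a well-defined holomorphic map $\mathbb{D}\to\mathbb{D}$. If $\beta_f(\sigma)<+\infty$, each of these has a non-tangential limit at $\sigma$ (limit as $z\to\sigma$ inside each region $\{z\in\mathbb{D}:|\sigma-z|<M(1-|z|)\}$, $M>1$), lying in $\partial\mathbb{D}$ and denoted $\Delta_{w_h,\ldots,w_1}f(\sigma)$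 (and $f(\sigma)$ for $h=0$). *)

theory Defs
  imports "HOL-Complex_Analysis.Complex_Analysis"
begin

abbreviation unit_disc :: "complex set" ("\<D>") where
  "\<D> \<equiv> ball 0 1"

definition boundary_dilation :: "(complex \<Rightarrow> complex) \<Rightarrow> complex \<Rightarrow> ereal" where
  "boundary_dilation g \<sigma> =
     Liminf (at \<sigma> within \<D>) (\<lambda>z. ereal ((1 - norm (g z)) / (1 - norm z)))"

text \<open>The empty product covers degree 0, giving exactly the constants of modulus 1. Functions are
  total in HOL, so the identity is only required on the disc.\<close>

definition is_blaschke_product :: "nat \<Rightarrow> (complex \<Rightarrow> complex) \<Rightarrow> bool" where
  "is_blaschke_product d B \<longleftrightarrow>
     (\<exists>(\<theta>::real) (a :: nat \<Rightarrow> complex). (\<forall>j\<in>{1..d}. a j \<in> \<D>) \<and>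
        (\<forall>z\<in>\<D>. B z = exp (\<i> * of_real \<theta>) * (\<Prod>j=1..d. (z - a j) / (1 - cnj (a j) * z))))"

definition hyp_quotient :: "(complex \<Rightarrow> complex) \<Rightarrow> complex \<Rightarrow> complex \<Rightarrow> complex" where
  "hyp_quotient g z w =
     (if z = w then deriv g w * of_real ((1 - (norm w)\<^sup>2) / (1 - (norm (g w))\<^sup>2))
      else ((g z - g w) / (1 - cnj (g w) * g z)) / ((z - w) / (1 - cnj w * z)))"

definition hyp_diff_quotient :: "complex \<Rightarrow> (complex \<Rightarrow> complex) \<Rightarrow> complex \<Rightarrow> complex" where
  "hyp_diff_quotient w g = (\<lambda>z. hyp_quotient g z w)"

text \<open>\<open>iter_hdq w h f\<close> is $\Delta_{w_h,\ldots,w_1} f$. The points are indexed from 1;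
  \<open>w 0\<close> is never used.\<close>

primrec iter_hdq :: "(nat \<Rightarrow> complex) \<Rightarrow> nat \<Rightarrow> (complex \<Rightarrow> complex) \<Rightarrow> complex \<Rightarrow> complex" where
  "iter_hdq w 0 f = f"
| "iter_hdq w (Suc h) f = hyp_diff_quotient (w (Suc h)) (iter_hdq w h f)"

definition stolz_region :: "complex \<Rightarrow> real \<Rightarrow> complex set" where
  "stolz_region \<sigma> M = {z \<in> \<D>. norm (\<sigma> - z) < M * (1 - norm z)}"

definition has_nontangential_limit :: "(complex \<Rightarrow> complex) \<Rightarrow> complex \<Rightarrow> complex \<Rightarrow> bool" where
  "has_nontangential_limit g \<sigma> l \<longleftrightarrow>
     (\<forall>M>1. (g \<longlongrightarrow> l) (at \<sigma> within stolz_region \<sigma> M))"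

definition nontangential_limit :: "(complex \<Rightarrow> complex) \<Rightarrow> complex \<Rightarrow> complex" where
  "nontangential_limit g \<sigma> = (THE l. has_nontangential_limit g \<sigma> l)"

lemma stolz_region_nontrivial:
  assumes "norm \<sigma> = 1" "M > 1"
  shows "at \<sigma> within stolz_region \<sigma> M \<noteq> bot"
proof -
  have "\<sigma> islimpt stolz_region \<sigma> M"
    unfolding islimpt_approachable
  proof (intro allI impI)
    fix e :: real assume e: "e > 0"
    define t where "t = min (e/2) (1/2)"
    have t: "0 < t" "t < 1" "t < e" using e by (auto simp: t_def)
    define z where "z = of_real (1 - t) * \<sigma>"
    have nz: "norm z = 1 - t" using assms t by (simp add: z_def norm_mult del: of_real_diff)
    have "\<sigma> - z = of_real t * \<sigma>" by (simp add: z_def algebra_simps)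
    hence d: "norm (\<sigma> - z) = t" using assms t by (simp add: norm_mult)
    have "z \<in> stolz_region \<sigma> M" using nz d t assms by (simp add: stolz_region_def)
    moreover have "z \<noteq> \<sigma>" using nz t assms by auto
    moreover have "dist z \<sigma> < e" using d t by (simp add: dist_norm norm_minus_commute)
    ultimately show "\<exists>x'\<in>stolz_region \<sigma> M. x' \<noteq> \<sigma> \<and> dist x' \<sigma> < e" by blast
  qed
  thus ?thesis by (simp add: trivial_limit_within)
qed

lemma nontangential_limit_eq:
  assumes "norm \<sigma> = 1" "has_nontangential_limit g \<sigma> l"
  shows "nontangential_limit g \<sigma> = l"
  unfolding nontangential_limit_def
proof (rule the_equality)
  fix l' assume "has_nontangential_limit g \<sigma> l'"
  hence "(g \<longlongrightarrow> l') (at \<sigma> within stolz_region \<sigma> 2)" "(g \<longlongrightarrow> l) (at \<sigma> within stolz_region \<sigma> 2)"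
    using assms(2) by (simp_all add: has_nontangential_limit_def)
  thus "l' = l"
    using tendsto_unique[OF stolz_region_nontrivial[OF assms(1), of 2]] by simp
qed (fact assms(2))

definition boundary_sum :: "(complex \<Rightarrow> complex) \<Rightarrow> complex \<Rightarrow> nat \<Rightarrow> (nat \<Rightarrow> complex) \<Rightarrow> real" where
  "boundary_sum f \<sigma> k w =
     (\<Sum>j=0..k. (1 - (norm (w (j+1)))\<^sup>2) / (norm (\<sigma> - w (j+1)))\<^sup>2 *
        (\<Prod>h=0..j.
           (norm (nontangential_limit (iter_hdq w h f) \<sigma> - iter_hdq w h f (w (h+1))))\<^sup>2 /
           (1 - (norm (iter_hdq w h f (w (h+1))))\<^sup>2)))"

end

theory Submission
  imports Defs "HOL-Computational_Algebra.Fundamental_Theorem_Algebra"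
begin

text \<open>
  Write \<open>\<phi>\<^sub>a(z) = (z - a) / (1 - cnj a * z)\<close>. The hyperbolic difference quotient \<open>g = \<Delta>\<^sub>w f\<close> is
  characterised by \<open>\<phi>\<^bsub>f(w)\<^esub> \<circ> f = \<phi>\<^sub>w * g\<close>. Inserting the identity
  \<open>1 - |\<phi>\<^sub>a(z)|\<^sup>2 = (1 - |a|\<^sup>2) (1 - |z|\<^sup>2) / |1 - cnj a * z|\<^sup>2\<close> on both sides, dividing by \<open>1 - |z|\<^sup>2\<close>
  and letting \<open>z\<close> tend to \<open>\<sigma>\<close> along the radius turns this product formula into
  \<open>\<beta>\<^sub>f(\<sigma>) = |f(\<sigma>) - f(w)|\<^sup>2 / (1 - |f(w)|\<^sup>2) * ((1 - |w|\<^sup>2) / |\<sigma> - w|\<^sup>2 + \<beta>\<^sub>g(\<sigma>))\<close>.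
  This is lemma \<open>boundary_dilation_hyp_quotient\<close>. Iterating it over \<open>w\<^sub>1, \<dots>, w\<^bsub>k+1\<^esub>\<close> writes
  \<open>\<beta>\<^sub>f(\<sigma>)\<close> as the sum of the theorem plus a positive multiple of the boundary dilation of the last
  iterated quotient, the one formed with all \<open>k + 1\<close> points (lemma \<open>boundary_dilation_expansion\<close>). That remainder is
  nonnegative, and it vanishes exactly when the last quotient is a unimodular constant, since a
  holomorphic map of the disc into itself has positive dilation at every boundary point. Finally
  \<open>\<Delta>\<^sub>w f\<close> is a Blaschke product of degree \<open>d\<close> if and only if \<open>f\<close> is one of degree \<open>d + 1\<close>
  (lemma \<open>blaschke_hyp_quotient_iff\<close>), so the vanishing of the remainder means that \<open>f\<close> is a Blaschke
  product of degree \<open>k + 1\<close>, whatever the points are.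

  Two ingredients carry this. The radial limits exist by the Julia--Caratheodory theorem, which
  follows from applying the Schwarz--Pick lemma at a sequence that realises the lower limit in
  \<open>\<beta>\<^sub>f(\<sigma>)\<close>. The statement on Blaschke products rests on their invariance under composition with a
  disc automorphism from the left (lemma \<open>moeb_comp_blaschke\<close>), which comes from factoring the
  numerator of the composition and reflecting it in the unit circle.
\<close>

section \<open>Disc automorphisms and the Schwarz--Pick lemma\<close>

abbreviation moeb :: "complex \<Rightarrow> complex \<Rightarrow> complex" where
  "moeb \<equiv> Moebius_function 0"

lemma moeb_denominator_nonzero:
  assumes "norm a < 1" "norm z \<le> 1"
  shows "1 - cnj a * z \<noteq> 0"
proof
  assume "1 - cnj a * z = 0"
  then have "norm (cnj a * z) = 1" by (metis eq_iff_diff_eq_0 norm_one)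
  moreover have "norm a * norm z \<le> norm a * 1" using assms by (intro mult_left_mono) auto
  ultimately show False using assms by (simp add: norm_mult)
qed

lemma moeb_gap_polynomial:
  "(norm (1 - cnj a * z))\<^sup>2 - (norm (z - a))\<^sup>2 = (1 - (norm a)\<^sup>2) * (1 - (norm z)\<^sup>2)"
  unfolding cmod_power2 by (simp add: power2_eq_square algebra_simps)

lemma one_minus_norm_moeb_squared:
  assumes "norm a < 1" "norm z \<le> 1"
  shows "1 - (norm (moeb a z))\<^sup>2 = (1 - (norm a)\<^sup>2) * (1 - (norm z)\<^sup>2) / (norm (1 - cnj a * z))\<^sup>2"
proof -
  have "norm (1 - cnj a * z) \<noteq> 0"
    using moeb_denominator_nonzero[OF assms] by simp
  then have "1 - (norm (moeb a z))\<^sup>2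
      = ((norm (1 - cnj a * z))\<^sup>2 - (norm (z - a))\<^sup>2) / (norm (1 - cnj a * z))\<^sup>2"
    by (simp add: Moebius_function_simple norm_divide power_divide divide_simps)
  then show ?thesis by (simp only: moeb_gap_polynomial)
qed

lemma moeb_eq_0_iff:
  assumes "norm a < 1" "norm z < 1"
  shows "moeb a z = 0 \<longleftrightarrow> z = a"
  using moeb_denominator_nonzero[of a z] assms by (simp add: Moebius_function_simple)

lemma one_minus_square_pos: "(x::real) \<ge> 0 \<Longrightarrow> x < 1 \<Longrightarrow> 1 - x\<^sup>2 > 0"
  by (simp add: power_less_one_iff abs_square_less_1)

text \<open>Conjugating \<open>f\<close> by the automorphisms that move \<open>w\<close> and \<open>f w\<close> to the origin reduces this to the
  Schwarz lemma.\<close>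

lemma Schwarz_Pick:
  assumes hol: "f holomorphic_on \<D>" and im: "f ` \<D> \<subseteq> \<D>"
    and w: "w \<in> \<D>" and z: "z \<in> \<D>"
  shows "norm (moeb (f w) (f z)) \<le> norm (moeb w z)"
proof -
  define F where "F = (\<lambda>u. moeb (f w) (f (moeb (- w) u)))"
  have fD: "norm (f u) < 1" if "norm u < 1" for u using im that by (auto simp: image_subset_iff)
  have nw: "norm w < 1" "norm (- w) < 1" using w by auto
  have "moeb (- w) ` \<D> \<subseteq> \<D>" using Moebius_function_norm_lt_1[OF nw(2)] by auto
  then have "(moeb (f w) \<circ> (f \<circ> moeb (- w))) holomorphic_on \<D>"
    using im fD nw
    by (intro holomorphic_on_compose_gen[where t = \<D>] Moebius_function_holomorphic hol)
       (auto simp: image_subset_iff)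
  then have "F holomorphic_on \<D>" by (simp add: F_def o_def)
  moreover have "F 0 = 0" by (simp add: F_def Moebius_function_of_zero Moebius_function_eq_zero)
  moreover have "norm (F u) < 1" if "norm u < 1" for u
    unfolding F_def using that nw by (intro Moebius_function_norm_lt_1 fD) auto
  moreover have "norm (moeb w z) < 1" using Moebius_function_norm_lt_1 w z by auto
  ultimately have "norm (F (moeb w z)) \<le> norm (moeb w z)"
    using Schwarz_Lemma(1)[of F "moeb w z"] by blast
  moreover have "moeb (- w) (moeb w z) = z"
    using Moebius_function_compose[of "- w" w z] w z by simp
  ultimately show ?thesis by (simp add: F_def)
qed

section \<open>The hyperbolic difference quotient as a function\<close>

text \<open>Multiplied out, the definition needs no case distinction: at \<open>z = w\<close> both sides vanish.\<close>

lemma hyp_quotient_mult_moeb: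
  assumes "w \<in> \<D>" "z \<in> \<D>" 
  shows "moeb w z * hyp_diff_quotient w f z = moeb (f w) (f z)"
proof (cases "z = w")
  case True
  then show ?thesis by (simp add: Moebius_function_eq_zero)
next
  case False
  then have "moeb w z \<noteq> 0" using assms moeb_eq_0_iff by auto
  then show ?thesis
    using False by (simp add: hyp_diff_quotient_def hyp_quotient_def Moebius_function_simple)
qed

text \<open>The singularity at \<open>w\<close> is removable, and the value prescribed there is the limit: it is the
  derivative at \<open>w\<close> of \<open>\<phi>\<^bsub>f(w)\<^esub> \<circ> f\<close>, which is \<open>f'(w) / (1 - |f w|\<^sup>2)\<close>, times the factor
  \<open>1 - |w|\<^sup>2\<close> left over from the denominator \<open>\<phi>\<^sub>w\<close>.\<close>

lemma hyp_quotient_holomorphic: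
  assumes hol: "f holomorphic_on \<D>" and im: "f ` \<D> \<subseteq> \<D>" and w: "w \<in> \<D>"
  shows "hyp_diff_quotient w f holomorphic_on \<D>"
proof -
  define F where "F = (\<lambda>z. moeb (f w) (f z))"
  have fw: "norm (f w) < 1" and nw: "norm w < 1" using im w by (auto simp: image_subset_iff)
  have "(moeb (f w) \<circ> f) holomorphic_on \<D>"
    using im fw hol
    by (intro holomorphic_on_compose_gen[where t = \<D>] Moebius_function_holomorphic) auto
  then have F: "F holomorphic_on \<D>" by (simp add: F_def o_def)
  have Fw: "F w = 0" by (simp add: F_def Moebius_function_eq_zero)
  have "(f has_field_derivative deriv f w) (at w)"
    using hol w holomorphic_derivI by (metis open_ball)
  moreover have "1 - cnj (f w) * f w \<noteq> 0" using moeb_denominator_nonzero[of "f w" "f w"] fw by simp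
  ultimately have "(F has_field_derivative
      (deriv f w * (1 - cnj (f w) * f w) - (f w - f w) * (- (cnj (f w) * deriv f w)))
        / ((1 - cnj (f w) * f w) * (1 - cnj (f w) * f w))) (at w)"
    unfolding F_def Moebius_function_simple
    by (auto intro!: derivative_eq_intros)
  then have "(F has_field_derivative deriv f w / (1 - cnj (f w) * f w)) (at w)"
    using \<open>1 - cnj (f w) * f w \<noteq> 0\<close> by simp
  then have dF: "deriv F w = deriv f w / (1 - cnj (f w) * f w)"
    by (rule DERIV_imp_deriv)
  have sq: "cnj a * a = of_real ((norm a)\<^sup>2)" for a :: complex
    by (metis complex_norm_square mult.commute)
  have "(\<lambda>z. if z = w then deriv F w else (F z - F w) / (z - w)) holomorphic_on \<D>"
    by (rule pole_lemma_open[OF F open_ball])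
  then have "(\<lambda>z. (if z = w then deriv F w else (F z - F w) / (z - w)) * (1 - cnj w * z)) holomorphic_on \<D>"
    by (intro holomorphic_intros)
  then show ?thesis
  proof (rule holomorphic_transform)
    fix z assume "z \<in> \<D>"
    show "(if z = w then deriv F w else (F z - F w) / (z - w)) * (1 - cnj w * z) = hyp_diff_quotient w f z"
    proof (cases "z = w")
      case True
      then show ?thesis
        by (simp add: hyp_diff_quotient_def hyp_quotient_def dF sq)
    next
      case False
      then show ?thesis
        by (simp add: hyp_diff_quotient_def hyp_quotient_def Fw) (simp add: F_def Moebius_function_simple)
    qed
  qed
qed

text \<open>Away from \<open>w\<close> this is the Schwarz--Pick lemma; at \<open>w\<close> it follows by continuity.\<close>

lemma hyp_quotient_norm_le_1:
  assumes hol: "f holomorphic_on \<D>" and im: "f ` \<D> \<subseteq> \<D>" and w: "w \<in> \<D>" and z: "z \<in> \<D>"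
  shows "norm (hyp_diff_quotient w f z) \<le> 1"
proof -
  let ?g = "hyp_diff_quotient w f"
  have off: "norm (?g z) \<le> 1" if "z \<in> \<D> - {w}" for z
  proof -
    have "norm (moeb w z) * norm (?g z) \<le> norm (moeb w z) * 1"
      using Schwarz_Pick[OF hol im w, of z] hyp_quotient_mult_moeb[OF w, of z f] that
      by (metis DiffD1 mult.right_neutral norm_mult)
    moreover have "norm (moeb w z) > 0" using moeb_eq_0_iff[of w z] w that by auto
    ultimately show ?thesis by (simp only: mult_le_cancel_left_pos)
  qed
  have "isCont ?g w"
    using hyp_quotient_holomorphic[OF hol im w] w holomorphic_on_imp_continuous_on
      continuous_on_interior interior_ball by metis
  then have "((\<lambda>z. norm (?g z)) \<longlongrightarrow> norm (?g w)) (at w)"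
    by (intro tendsto_norm) (simp add: isCont_def)
  moreover have "\<forall>\<^sub>F z in at w. norm (?g z) \<le> 1"
    using eventually_at_in_open[OF open_ball w] by eventually_elim (use off in auto)
  ultimately have "norm (?g w) \<le> 1"
    by (intro tendsto_upperbound) auto
  then show ?thesis using off z by (cases "z = w") auto
qed

lemma is_blaschke_product_0_iff:
  "is_blaschke_product 0 g \<longleftrightarrow> (\<exists>u. norm u = 1 \<and> (\<forall>z\<in>\<D>. g z = u))"
proof
  assume "is_blaschke_product 0 g"
  then obtain \<theta> :: real where "\<forall>z\<in>\<D>. g z = exp (\<i> * of_real \<theta>)"
    by (auto simp: is_blaschke_product_def)
  then show "\<exists>u. norm u = 1 \<and> (\<forall>z\<in>\<D>. g z = u)" by (metis norm_exp_i_times)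
next
  assume "\<exists>u. norm u = 1 \<and> (\<forall>z\<in>\<D>. g z = u)"
  then obtain u where u: "norm u = 1" "\<forall>z\<in>\<D>. g z = u" by blast
  then obtain \<theta> where "u = exp (\<i> * of_real \<theta>)" by (metis complex_norm_eq_1_exp u(1))
  then show "is_blaschke_product 0 g"
    using u by (auto simp: is_blaschke_product_def)
qed

text \<open>By the maximum modulus principle, the quotient leaves the open disc only if it is a unimodular constant,
  and then no further quotient can be formed.\<close>

lemma hyp_quotient_dichotomy:
  assumes hol: "f holomorphic_on \<D>" and im: "f ` \<D> \<subseteq> \<D>" and w: "w \<in> \<D>"
  shows "hyp_diff_quotient w f ` \<D> \<subseteq> \<D> \<or> is_blaschke_product 0 (hyp_diff_quotient w f)"
proof (cases "\<exists>\<xi>\<in>\<D>. norm (hyp_diff_quotient w f \<xi>) = 1")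
  case True
  then obtain \<xi> where \<xi>: "\<xi> \<in> \<D>" "norm (hyp_diff_quotient w f \<xi>) = 1" by blast
  have "hyp_diff_quotient w f constant_on \<D>"
    by (rule maximum_modulus_principle[OF hyp_quotient_holomorphic[OF hol im w], where U = \<D> and \<xi> = \<xi>])
       (use \<xi> hyp_quotient_norm_le_1[OF hol im w] in auto)
  then have "is_blaschke_product 0 (hyp_diff_quotient w f)"
    using \<xi> by (auto simp: is_blaschke_product_0_iff constant_on_def)
  then show ?thesis ..
next
  case False
  then have "hyp_diff_quotient w f ` \<D> \<subseteq> \<D>"
    using hyp_quotient_norm_le_1[OF hol im w] by (force simp: less_le)
  then show ?thesis ..
qed

section \<open>Blaschke products and difference quotients\<close>

text \<open>Zeros are collected in a multiset rather than an indexed family, so that a zero can be added or removed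
  without renumbering.\<close>

lemma is_blaschke_product_iff_mset:
  "is_blaschke_product d B \<longleftrightarrow>
     (\<exists>u A. norm u = 1 \<and> size A = d \<and> set_mset A \<subseteq> \<D> \<and> (\<forall>z\<in>\<D>. B z = u * (\<Prod>a\<in>#A. moeb a z)))"
proof
  assume "is_blaschke_product d B"
  then obtain \<theta> :: real and a where a: "\<forall>j\<in>{1..d}. a j \<in> \<D>"
    and B: "\<forall>z\<in>\<D>. B z = exp (\<i> * of_real \<theta>) * (\<Prod>j=1..d. (z - a j) / (1 - cnj (a j) * z))"
    by (auto simp: is_blaschke_product_def)
  let ?A = "image_mset a (mset_set {1..d})"
  have "(\<Prod>j=1..d. (z - a j) / (1 - cnj (a j) * z)) = (\<Prod>a\<in>#?A. moeb a z)" for z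
    by (simp add: prod_unfold_prod_mset Moebius_function_simple image_mset.compositionality o_def)
  then have "\<forall>z\<in>\<D>. B z = exp (\<i> * of_real \<theta>) * (\<Prod>a\<in>#?A. moeb a z)"
    using B by simp
  moreover have "size ?A = d" "set_mset ?A \<subseteq> \<D>" using a by auto
  ultimately show "\<exists>u A. norm u = 1 \<and> size A = d \<and> set_mset A \<subseteq> \<D> \<and> (\<forall>z\<in>\<D>. B z = u * (\<Prod>a\<in>#A. moeb a z))"
    by (intro exI[of _ "exp (\<i> * of_real \<theta>)"] exI[of _ ?A]) simp
next
  assume "\<exists>u A. norm u = 1 \<and> size A = d \<and> set_mset A \<subseteq> \<D> \<and> (\<forall>z\<in>\<D>. B z = u * (\<Prod>a\<in>#A. moeb a z))"
  then obtain u A where u: "norm u = 1" and A: "size A = d" "set_mset A \<subseteq> \<D>"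
    and B: "\<forall>z\<in>\<D>. B z = u * (\<Prod>a\<in>#A. moeb a z)" by blast
  obtain \<theta> where \<theta>: "u = exp (\<i> * of_real \<theta>)" by (metis complex_norm_eq_1_exp u)
  obtain as where as: "mset as = A" by (metis ex_mset)
  then have len: "length as = d" and sub: "set as \<subseteq> \<D>" using A by auto
  define a where "a = (\<lambda>j. as ! (j - 1))"
  have "(\<Prod>a\<in>#A. moeb a z) = (\<Prod>j=1..d. moeb (a j) z)" for z
  proof -
    have "(\<Prod>a\<in>#A. moeb a z) = prod_list (map (\<lambda>a. moeb a z) as)"
      by (metis as mset_map prod_mset_prod_list)
    also have "\<dots> = (\<Prod>i<d. moeb (as ! i) z)"
      by (simp add: prod.list_conv_set_nth len atLeast0LessThan)
    also have "\<dots> = (\<Prod>j=1..d. moeb (a j) z)"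
      by (simp add: prod.atLeast1_atMost_eq a_def)
    finally show ?thesis .
  qed
  moreover have "\<forall>j\<in>{1..d}. a j \<in> \<D>"
  proof
    fix j assume "j \<in> {1..d}"
    then have "a j \<in> set as" using len by (auto simp: a_def intro!: nth_mem)
    then show "a j \<in> \<D>" using sub by blast
  qed
  ultimately show "is_blaschke_product d B"
    unfolding is_blaschke_product_def
    by (intro exI[of _ \<theta>] exI[of _ a]) (use B \<theta> in \<open>simp add: Moebius_function_simple\<close>)
qed

definition numer_poly :: "complex multiset \<Rightarrow> complex poly" where
  "numer_poly A = (\<Prod>a\<in>#A. [:- a, 1:])"

definition denom_poly :: "complex multiset \<Rightarrow> complex poly" where
  "denom_poly A = (\<Prod>a\<in>#A. [:1, - cnj a:])"

lemma poly_numer_poly_add_mset: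
  "poly (numer_poly (add_mset a A)) z = (z - a) * poly (numer_poly A) z"
  by (simp add: numer_poly_def algebra_simps)

lemma poly_denom_poly_add_mset:
  "poly (denom_poly (add_mset a A)) z = (1 - cnj a * z) * poly (denom_poly A) z"
  by (simp add: denom_poly_def algebra_simps)

lemma prod_moeb_conv_poly:
  "(\<Prod>a\<in>#A. moeb a z) = poly (numer_poly A) z / poly (denom_poly A) z"
proof (induction A)
  case empty
  then show ?case by (simp add: numer_poly_def denom_poly_def)
next
  case (add a A)
  then show ?case
    by (simp add: poly_numer_poly_add_mset poly_denom_poly_add_mset Moebius_function_simple)
qed

lemma numer_poly_degree_coeff:
  "degree (numer_poly A) \<le> size A \<and> coeff (numer_poly A) (size A) = 1"
proof (induction A)
  case empty
  then show ?case by (simp add: numer_poly_def)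
next
  case (add a A)
  have eq: "numer_poly (add_mset a A) = [:- a, 1:] * numer_poly A" by (simp add: numer_poly_def)
  have "degree ([:- a, 1:] * numer_poly A) \<le> 1 + size A"
    using degree_mult_le[of "[:- a, 1:]" "numer_poly A"] add by simp
  moreover have "coeff ([:- a, 1:] * numer_poly A) (1 + size A) = 1"
    using add by (simp add: coeff_eq_0)
  ultimately show ?case by (simp add: eq del: mult_pCons_left)
qed

lemma denom_poly_degree_coeff:
  assumes "set_mset A \<subseteq> \<D>"
  shows "degree (denom_poly A) \<le> size A \<and> norm (coeff (denom_poly A) (size A)) \<le> 1"
  using assms
proof (induction A)
  case empty
  then show ?case by (simp add: denom_poly_def)
next
  case (add a A)
  have eq: "denom_poly (add_mset a A) = [:1, - cnj a:] * denom_poly A" by (simp add: denom_poly_def)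
  have le: "degree [:1, - cnj a:] \<le> 1" by simp
  have "degree ([:1, - cnj a:] * denom_poly A) \<le> 1 + size A"
  proof -
    have "degree ([:1, - cnj a:] * denom_poly A) \<le> degree [:1, - cnj a:] + degree (denom_poly A)"
      by (rule degree_mult_le)
    also have "\<dots> \<le> 1 + size A" using add le by (intro add_mono) auto
    finally show ?thesis .
  qed
  moreover have "coeff ([:1, - cnj a:] * denom_poly A) (1 + size A) = - cnj a * coeff (denom_poly A) (size A)"
    using add by (simp add: coeff_eq_0)
  moreover have "norm (- cnj a * coeff (denom_poly A) (size A)) \<le> 1"
    using add mult_mono[of "norm a" 1 "norm (coeff (denom_poly A) (size A))" 1] by (simp add: norm_mult)
  ultimately show ?case by (simp add: eq del: mult_pCons_left)
qed

text \<open>Reflection in the unit circle exchanges numerator and denominator. It recovers the denominator of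
  a Blaschke product from its numerator alone.\<close>

lemma poly_reflection:
  assumes "z \<noteq> 0"
  shows "z ^ size A * cnj (poly (numer_poly A) (1 / cnj z)) = poly (denom_poly A) z"
    and "z ^ size A * cnj (poly (denom_poly A) (1 / cnj z)) = poly (numer_poly A) z"
proof -
  have "z ^ size A * cnj (poly (numer_poly A) (1 / cnj z)) = poly (denom_poly A) z \<and>
        z ^ size A * cnj (poly (denom_poly A) (1 / cnj z)) = poly (numer_poly A) z"
  proof (induction A)
    case empty
    then show ?case by (simp add: numer_poly_def denom_poly_def)
  next
    case (add a A)
    have split: "z ^ size (add_mset a A) * cnj (x * y) = (z * cnj x) * (z ^ size A * cnj y)" for x y
      by simp
    have factors: "z * cnj (1 / cnj z - a) = 1 - cnj a * z" "z * cnj (1 - cnj a * (1 / cnj z)) = z - a"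
      using assms by (simp_all add: field_simps)
    show ?case
      by (simp only: poly_numer_poly_add_mset poly_denom_poly_add_mset split factors add simp_thms)
  qed
  then show "z ^ size A * cnj (poly (numer_poly A) (1 / cnj z)) = poly (denom_poly A) z"
    and "z ^ size A * cnj (poly (denom_poly A) (1 / cnj z)) = poly (numer_poly A) z" by auto
qed

lemma denom_poly_nonzero:
  assumes "set_mset A \<subseteq> \<D>" "norm z < 1"
  shows "poly (denom_poly A) z \<noteq> 0"
  using assms
proof (induction A)
  case (add a A)
  have "1 - cnj a * z \<noteq> 0" using moeb_denominator_nonzero add.prems by auto
  then show ?case using add by (simp add: poly_denom_poly_add_mset)
qed (simp add: denom_poly_def)

lemma denom_poly_le_numer_poly:
  assumes "set_mset A \<subseteq> \<D>" "norm z \<ge> 1"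
  shows "norm (poly (denom_poly A) z) \<le> norm (poly (numer_poly A) z)"
  using assms
proof (induction A)
  case (add a A)
  have "(1 - (norm a)\<^sup>2) * (1 - (norm z)\<^sup>2) \<le> 0"
    using add.prems one_minus_square_pos[of "norm a"] by (intro mult_nonneg_nonpos) (auto simp: less_imp_le)
  then have "(norm (1 - cnj a * z))\<^sup>2 \<le> (norm (z - a))\<^sup>2"
    using moeb_gap_polynomial[of a z] by linarith
  then have "norm (1 - cnj a * z) \<le> norm (z - a)" by (simp add: power2_le_iff_abs_le)
  moreover have "norm (poly (denom_poly A) z) \<le> norm (poly (numer_poly A) z)" using add by simp
  ultimately have "norm (1 - cnj a * z) * norm (poly (denom_poly A) z) \<le> norm (z - a) * norm (poly (numer_poly A) z)"
    by (intro mult_mono) auto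
  then show ?case
    by (simp add: poly_numer_poly_add_mset poly_denom_poly_add_mset norm_mult)
qed (simp add: numer_poly_def denom_poly_def)

lemma numer_poly_zeros: "poly (numer_poly A) z = 0 \<longleftrightarrow> z \<in># A"
proof (induction A)
  case empty
  then show ?case by (simp add: numer_poly_def)
next
  case (add a A)
  then show ?case by (auto simp: poly_numer_poly_add_mset)
qed

lemma moeb_divide:
  assumes "y \<noteq> 0"
  shows "moeb c (x / y) = (x - c * y) / (y - cnj c * x)"
proof -
  have "x / y - c = (x - c * y) / y" "1 - cnj c * (x / y) = (y - cnj c * x) / y"
    using assms by (simp_all add: diff_divide_distrib)
  then show ?thesis using assms by (simp add: Moebius_function_simple)
qed

text \<open>
  Let \<open>B = u p / q\<close> with \<open>p\<close>, \<open>q\<close> the numerator and denominator polynomials. Then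
  \<open>\<phi>\<^sub>c \<circ> B = N / D\<close> with \<open>N = u p - c q\<close> and \<open>D = q - cnj c * u p\<close>. The polynomial \<open>N\<close> has degree
  exactly \<open>d\<close>, because the coefficient of \<open>z ^ d\<close> in \<open>c q\<close> has modulus less than \<open>1 = |u|\<close>, and all its roots lie in
  the disc, because \<open>|q| \<le> |p|\<close> outside of it. Up to a unimodular factor, \<open>D\<close> is the reflection of
  \<open>N\<close>, hence it is the denominator belonging to the roots of \<open>N\<close>.
\<close>

lemma moeb_comp_blaschke:
  assumes B: "is_blaschke_product d B" and c: "norm c < 1"
  shows "is_blaschke_product d (\<lambda>z. moeb c (B z))"
proof -
  from B obtain u A where u: "norm u = 1" and A: "size A = d" "set_mset A \<subseteq> \<D>"
    and B: "\<forall>z\<in>\<D>. B z = u * (\<Prod>a\<in>#A. moeb a z)" unfolding is_blaschke_product_iff_mset by blast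
  define p where "p = numer_poly A"
  define q where "q = denom_poly A"
  define N where "N = smult u p - smult c q"
  define D where "D = q - smult (cnj c * u) p"
  note p = numer_poly_degree_coeff[of A, folded p_def, unfolded A(1)]
  note q = denom_poly_degree_coeff[of A, folded q_def, unfolded A(1), OF A(2)]
  have cu: "cnj u * u = 1" using u by (metis complex_norm_square mult.commute of_real_1 power_one)
  have "degree N \<le> d"
    unfolding N_def using p q by (intro degree_diff_le) (auto intro: order_trans[OF degree_smult_le])
  moreover have "coeff N d \<noteq> 0"
  proof
    assume "coeff N d = 0"
    then have "u = c * coeff q d" using p by (simp add: N_def)
    then have "norm u = norm c * norm (coeff q d)" by (simp add: norm_mult)
    also have "\<dots> \<le> norm c * 1" using q by (intro mult_left_mono) auto
    finally show False using u c by simp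
  qed
  ultimately have degN: "degree N = d" using le_degree[of N d] by simp
  have "N \<noteq> 0" using \<open>coeff N d \<noteq> 0\<close> by auto
  then obtain R where R: "size R = d" "N = smult (lead_coeff N) (\<Prod>x\<in>#R. [:- x, 1:])"
    using alg_closed_imp_factorization[of N] degN by metis
  define \<kappa> where "\<kappa> = lead_coeff N"
  have \<kappa>: "\<kappa> \<noteq> 0" using \<open>N \<noteq> 0\<close> by (simp add: \<kappa>_def)
  have NR: "N = smult \<kappa> (numer_poly R)" using R(2) by (simp add: numer_poly_def \<kappa>_def)
  have RD: "set_mset R \<subseteq> \<D>"
  proof
    fix z assume "z \<in># R"
    then have "poly N z = 0" by (simp add: NR numer_poly_zeros)
    then have eq: "u * poly p z = c * poly q z" by (simp add: N_def)
    then have eq': "norm (poly p z) = norm c * norm (poly q z)"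
      using u by (metis norm_mult mult_1)
    show "z \<in> \<D>"
    proof (rule ccontr)
      assume "z \<notin> \<D>"
      then have z: "norm z \<ge> 1" by simp
      have "norm (poly q z) \<le> norm c * norm (poly q z)"
        using denom_poly_le_numer_poly[OF A(2) z] eq' by (simp add: p_def q_def)
      then have "(1 - norm c) * norm (poly q z) \<le> 0" by (simp add: algebra_simps)
      then have "norm (poly q z) \<le> 0" using c by (simp add: mult_le_0_iff)
      then have "poly p z = 0" using eq' by simp
      then have "z \<in># A" by (simp add: p_def numer_poly_zeros)
      then show False using A(2) \<open>z \<notin> \<D>\<close> by blast
    qed
  qed
  (* Reflection is only available at nonzero points; the extra factor makes the identity hold at 0 too. *)
  have "poly ([:0, 1:] * (D - smult (u * cnj \<kappa>) (denom_poly R))) z = 0" for z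
  proof (cases "z = 0")
    case False
    have "z ^ d * cnj (poly N (1 / cnj z)) =
        cnj u * (z ^ size A * cnj (poly p (1 / cnj z))) - cnj c * (z ^ size A * cnj (poly q (1 / cnj z)))"
      by (simp add: N_def A(1) algebra_simps)
    also have "\<dots> = cnj u * poly q z - cnj c * poly p z"
      by (simp only: p_def q_def poly_reflection[OF False])
    finally have 1: "z ^ d * cnj (poly N (1 / cnj z)) = cnj u * poly q z - cnj c * poly p z" .
    have "z ^ d * cnj (poly N (1 / cnj z)) = cnj \<kappa> * (z ^ size R * cnj (poly (numer_poly R) (1 / cnj z)))"
      by (simp add: NR R(1))
    also have "\<dots> = cnj \<kappa> * poly (denom_poly R) z"
      by (simp only: poly_reflection[OF False])
    finally have "cnj u * poly q z - cnj c * poly p z = cnj \<kappa> * poly (denom_poly R) z" using 1 by simp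
    then have "u * (cnj u * poly q z - cnj c * poly p z) = u * (cnj \<kappa> * poly (denom_poly R) z)" by simp
    then have "(cnj u * u) * poly q z - cnj c * u * poly p z = u * cnj \<kappa> * poly (denom_poly R) z"
      by (simp add: algebra_simps)
    then show ?thesis by (simp add: D_def cu)
  qed simp
  then have "[:0, 1:] * (D - smult (u * cnj \<kappa>) (denom_poly R)) = 0"
    by (subst poly_all_0_iff_0[symmetric]) blast
  then have "D - smult (u * cnj \<kappa>) (denom_poly R) = 0"
    by (simp del: mult_pCons_left)
  then have DR: "D = smult (u * cnj \<kappa>) (denom_poly R)" by simp
  define v where "v = \<kappa> / (u * cnj \<kappa>)"
  have "norm v = 1" using u \<kappa> by (simp add: v_def norm_divide norm_mult)
  moreover have "moeb c (B z) = v * (\<Prod>a\<in>#R. moeb a z)" if "z \<in> \<D>" for z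
  proof -
    have nz: "poly q z \<noteq> 0" unfolding q_def using denom_poly_nonzero A that by auto
    have "B z = u * poly p z / poly q z"
      using B that by (simp add: prod_moeb_conv_poly p_def q_def)
    then have "moeb c (B z) = (u * poly p z - c * poly q z) / (poly q z - cnj c * (u * poly p z))"
      using moeb_divide[OF nz] by simp
    also have "\<dots> = poly N z / poly D z" by (simp add: N_def D_def)
    also have "\<dots> = v * (\<Prod>a\<in>#R. moeb a z)"
      by (simp add: NR DR v_def prod_moeb_conv_poly)
    finally show ?thesis .
  qed
  ultimately show ?thesis
    unfolding is_blaschke_product_iff_mset
    by (intro exI[of _ v] exI[of _ R]) (simp add: R(1) RD)
qed

text \<open>The relation \<open>\<phi>\<^bsub>f(w)\<^esub> \<circ> f = \<phi>\<^sub>w * \<Delta>\<^sub>w f\<close> says that passing to the quotient composes with an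
  automorphism, which keeps the degree, and then removes the zero at \<open>w\<close>.\<close>

lemma blaschke_hyp_quotient_iff:
  assumes hol: "f holomorphic_on \<D>" and im: "f ` \<D> \<subseteq> \<D>" and w: "w \<in> \<D>"
  shows "is_blaschke_product d (hyp_diff_quotient w f) \<longleftrightarrow> is_blaschke_product (Suc d) f"
proof
  have fw: "norm (f w) < 1" and nw: "norm w < 1" using im w by (auto simp: image_subset_iff)
  let ?F = "\<lambda>z. moeb (f w) (f z)"
  {
    assume "is_blaschke_product d (hyp_diff_quotient w f)"
    then obtain u A where u: "norm u = 1" and A: "size A = d" "set_mset A \<subseteq> \<D>"
      and B: "\<forall>z\<in>\<D>. hyp_diff_quotient w f z = u * (\<Prod>a\<in>#A. moeb a z)"
      unfolding is_blaschke_product_iff_mset by blast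
    have "\<forall>z\<in>\<D>. ?F z = u * (\<Prod>a\<in>#add_mset w A. moeb a z)"
    proof
      fix z assume z: "z \<in> \<D>"
      have "?F z = moeb w z * hyp_diff_quotient w f z" using hyp_quotient_mult_moeb[OF w z] by simp
      then show "?F z = u * (\<Prod>a\<in>#add_mset w A. moeb a z)" using B z by simp
    qed
    then have "is_blaschke_product (Suc d) ?F"
      unfolding is_blaschke_product_iff_mset
      by (intro exI[of _ u] exI[of _ "add_mset w A"]) (use u A w in auto)
    then have "is_blaschke_product (Suc d) (\<lambda>z. moeb (- f w) (?F z))"
      by (rule moeb_comp_blaschke) (use fw in simp)
    moreover have "moeb (- f w) (?F z) = f z" if "z \<in> \<D>" for z
    proof -
      have "norm (f z) < 1" using im that by (auto simp: image_subset_iff)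
      then show ?thesis using Moebius_function_compose[of "- f w" "f w" "f z"] fw by simp
    qed
    ultimately show "is_blaschke_product (Suc d) f"
      by (simp add: is_blaschke_product_iff_mset)
  }
  assume "is_blaschke_product (Suc d) f"
  then have "is_blaschke_product (Suc d) ?F" by (rule moeb_comp_blaschke[OF _ fw])
  then obtain u A where u: "norm u = 1" and A: "size A = Suc d" "set_mset A \<subseteq> \<D>"
    and B: "\<forall>z\<in>\<D>. ?F z = u * (\<Prod>a\<in>#A. moeb a z)"
    unfolding is_blaschke_product_iff_mset by blast
  have "u * (\<Prod>a\<in>#A. moeb a w) = 0"
    using bspec[OF B w] by (simp only: Moebius_function_eq_zero)
  then have "(\<Prod>a\<in>#A. moeb a w) = 0" using u by auto
  then obtain a where a: "a \<in># A" "moeb a w = 0" by (auto simp: prod_mset_zero_iff)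
  then have "w \<in># A" using moeb_eq_0_iff[of a w] A nw by auto
  then obtain A' where A': "A = add_mset w A'" by (metis mset_add)
  let ?P = "\<lambda>z. u * (\<Prod>a\<in>#A'. moeb a z)"
  have A'D: "set_mset A' \<subseteq> \<D>" using A A' by auto
  have off: "hyp_diff_quotient w f z = ?P z" if "z \<in> \<D> - {w}" for z
  proof -
    have "moeb w z * hyp_diff_quotient w f z = moeb w z * ?P z"
      using B that hyp_quotient_mult_moeb[OF w, of z f] by (simp add: A')
    moreover have "moeb w z \<noteq> 0" using moeb_eq_0_iff[of w z] w that by auto
    ultimately show ?thesis by (metis mult_left_cancel)
  qed
  (* The cancellation fails at w itself, where the two sides agree by continuity. *)
  have lim1: "(hyp_diff_quotient w f \<longlongrightarrow> hyp_diff_quotient w f w) (at w)"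
    using hyp_quotient_holomorphic[OF hol im w] w holomorphic_on_imp_continuous_on
      continuous_on_interior interior_ball isCont_def by metis
  have "isCont ?P w"
    unfolding prod_moeb_conv_poly
    by (intro continuous_intros) (use denom_poly_nonzero[OF A'D nw] in auto)
  then have "(?P \<longlongrightarrow> ?P w) (at w)" by (simp add: isCont_def)
  moreover have "\<forall>\<^sub>F z in at w. ?P z = hyp_diff_quotient w f z"
    using eventually_at_in_open[OF open_ball w] by eventually_elim (use off in auto)
  ultimately have "(hyp_diff_quotient w f \<longlongrightarrow> ?P w) (at w)"
    by (rule Lim_transform_eventually)
  then have "hyp_diff_quotient w f w = ?P w"
    using lim1 tendsto_unique by (metis at_neq_bot)
  then have "\<forall>z\<in>\<D>. hyp_diff_quotient w f z = ?P z" using off by blast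
  then show "is_blaschke_product d (hyp_diff_quotient w f)"
    unfolding is_blaschke_product_iff_mset
    by (intro exI[of _ u] exI[of _ A']) (use u A A' A'D in auto)
qed

section \<open>The Julia--Caratheodory theorem\<close>

lemma norm_one_minus_cnj_mult_unimodular:
  assumes "norm \<tau> = 1"
  shows "norm (1 - cnj \<tau> * v) = norm (\<tau> - v)"
proof -
  have "\<tau> * cnj \<tau> = 1" using assms by (metis complex_norm_square of_real_1 power_one)
  then have "\<tau> * (1 - cnj \<tau> * v) = \<tau> - v" by (simp add: algebra_simps)
  then show ?thesis using assms by (metis mult_1 norm_mult)
qed

text \<open>
  Julia's lemma. Choose points \<open>u\<close> tending to \<open>\<sigma>\<close> along which \<open>(1 - |f u|) / (1 - |u|)\<close> does not exceed
  \<open>b\<close> in the limit and \<open>f u\<close> converges to some \<open>\<tau>\<close>; the bound forces \<open>|\<tau>| = 1\<close>. The Schwarz--Pick inequality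
  for the pair \<open>u, z\<close> is an upper bound for \<open>|1 - cnj (f u) * f z|\<^sup>2\<close> with the factor
  \<open>(1 - |f u|\<^sup>2) / (1 - |u|\<^sup>2)\<close>, so it survives the passage to the limit. Both sides are kept free of
  denominators, since \<open>b > 0\<close> is itself a consequence.
\<close>

lemma Julia_inequality:
  assumes hol: "f holomorphic_on \<D>" and im: "f ` \<D> \<subseteq> \<D>"
    and \<sigma>: "norm \<sigma> = 1" and b: "boundary_dilation f \<sigma> = ereal b"
  shows "\<exists>\<tau>. norm \<tau> = 1 \<and>
    (\<forall>z\<in>\<D>. (norm (\<tau> - f z))\<^sup>2 * (1 - (norm z)\<^sup>2) \<le> b * (norm (\<sigma> - z))\<^sup>2 * (1 - (norm (f z))\<^sup>2))"
proof -
  have fD: "norm (f u) < 1" if "norm u < 1" for u using im that by (auto simp: image_subset_iff)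
  have "\<exists>z. norm z < 1 \<and> norm (z - \<sigma>) < 1 / Suc n \<and> (1 - norm (f z)) / (1 - norm z) < b + 1 / Suc n" for n
  proof (rule ccontr)
    assume neg: "\<not> ?thesis"
    have *: "b + 1 / Suc n \<le> (1 - norm (f z)) / (1 - norm z)"
      if "norm z < 1" "norm (z - \<sigma>) < 1 / Suc n" for z
      using neg that by (meson not_le)
    have "\<forall>\<^sub>F z in at \<sigma> within \<D>. ereal (b + 1 / Suc n) \<le> ereal ((1 - norm (f z)) / (1 - norm z))"
      unfolding eventually_at
    proof (intro exI[of _ "1 / real (Suc n)"] conjI ballI impI)
      fix z assume "z \<in> \<D>" "z \<noteq> \<sigma> \<and> dist z \<sigma> < 1 / real (Suc n)"
      then show "ereal (b + 1 / Suc n) \<le> ereal ((1 - norm (f z)) / (1 - norm z))"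
        unfolding ereal_less_eq(3) by (intro *) (simp_all only: dist_norm mem_ball_0)
    qed simp
    then have "ereal (b + 1 / Suc n) \<le> boundary_dilation f \<sigma>"
      unfolding boundary_dilation_def by (rule Liminf_bounded)
    then show False using b by (simp add: field_simps)
  qed
  then obtain Z where Z: "\<And>n. norm (Z n) < 1" "\<And>n. norm (Z n - \<sigma>) < 1 / Suc n"
    "\<And>n. (1 - norm (f (Z n))) / (1 - norm (Z n)) < b + 1 / Suc n"
    by metis
  have "(\<lambda>n. Z n - \<sigma>) \<longlonglongrightarrow> 0" by (rule LIMSEQ_norm_0) (use Z(2) in auto)
  then have Zlim: "Z \<longlonglongrightarrow> \<sigma>" by (rule LIM_zero_cancel)
  have "bounded (range (\<lambda>n. f (Z n)))"
    by (rule boundedI[of _ 1]) (use fD Z(1) in \<open>auto intro: less_imp_le\<close>)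
  then obtain \<tau> r where r: "strict_mono r" and "((\<lambda>n. f (Z n)) \<circ> r) \<longlonglongrightarrow> \<tau>"
    using bounded_imp_convergent_subsequence by blast
  then have flim: "(\<lambda>n. f (Z (r n))) \<longlonglongrightarrow> \<tau>" by (simp add: o_def)
  have zlim: "(\<lambda>n. Z (r n)) \<longlonglongrightarrow> \<sigma>" using LIMSEQ_subseq_LIMSEQ[OF Zlim r] by (simp add: o_def)
  have elim: "(\<lambda>n. 1 / real (Suc (r n))) \<longlonglongrightarrow> 0"
    using LIMSEQ_subseq_LIMSEQ[OF LIMSEQ_inverse_real_of_nat r] by (simp add: o_def inverse_eq_divide)
  have gap: "1 - norm (f (Z (r n))) \<le> (b + 1 / real (Suc (r n))) * (1 - norm (Z (r n)))" for n
    using Z(1,3)[of "r n"] by (simp add: pos_divide_less_eq less_imp_le)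
  have "norm \<tau> \<le> 1"
    by (rule LIMSEQ_le_const2[OF tendsto_norm[OF flim]]) (use fD Z(1) in \<open>auto intro: less_imp_le\<close>)
  moreover have "1 - norm \<tau> \<le> (b + 0) * (1 - norm \<sigma>)"
  proof (rule LIMSEQ_le)
    show "(\<lambda>n. 1 - norm (f (Z (r n)))) \<longlonglongrightarrow> 1 - norm \<tau>"
      by (intro tendsto_intros flim)
    show "(\<lambda>n. (b + 1 / real (Suc (r n))) * (1 - norm (Z (r n)))) \<longlonglongrightarrow> (b + 0) * (1 - norm \<sigma>)"
      by (intro tendsto_intros zlim elim)
  qed (use gap in blast)
  ultimately have \<tau>: "norm \<tau> = 1" using \<sigma> by simp
  have "(norm (\<tau> - f z))\<^sup>2 * (1 - (norm z)\<^sup>2) \<le> b * (norm (\<sigma> - z))\<^sup>2 * (1 - (norm (f z))\<^sup>2)"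
    if z: "z \<in> \<D>" for z
  proof -
    have fz: "norm (f z) < 1" and nz: "norm z < 1" using z fD by auto
    have gz: "1 - (norm (f z))\<^sup>2 \<ge> 0"
      using one_minus_square_pos[of "norm (f z)"] fz by simp
    have "(norm (1 - cnj (f u) * f z))\<^sup>2 * (1 + norm u) * (1 - (norm z)\<^sup>2)
        \<le> 2 * (b + e) * (norm (1 - cnj u * z))\<^sup>2 * (1 - (norm (f z))\<^sup>2)"
      if u: "norm u < 1" and le: "1 - norm (f u) \<le> (b + e) * (1 - norm u)" for u e
    proof -
      have fu: "norm (f u) < 1" using fD u by simp
      have p1: "(norm (1 - cnj u * z))\<^sup>2 > 0" using moeb_denominator_nonzero[of u z] u nz by simp
      have p2: "(norm (1 - cnj (f u) * f z))\<^sup>2 > 0"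
        using moeb_denominator_nonzero[of "f u" "f z"] fu fz by simp
      have "(norm (moeb (f u) (f z)))\<^sup>2 \<le> (norm (moeb u z))\<^sup>2"
        by (rule power_mono[OF Schwarz_Pick[OF hol im]]) (use u z in auto)
      then have "1 - (norm (moeb u z))\<^sup>2 \<le> 1 - (norm (moeb (f u) (f z)))\<^sup>2" by simp
      then have "(1 - (norm u)\<^sup>2) * (1 - (norm z)\<^sup>2) / (norm (1 - cnj u * z))\<^sup>2
          \<le> (1 - (norm (f u))\<^sup>2) * (1 - (norm (f z))\<^sup>2) / (norm (1 - cnj (f u) * f z))\<^sup>2"
        using one_minus_norm_moeb_squared[of u z] one_minus_norm_moeb_squared[of "f u" "f z"] u nz fu fz
        by simp
      then have main: "(norm (1 - cnj (f u) * f z))\<^sup>2 * ((1 - (norm u)\<^sup>2) * (1 - (norm z)\<^sup>2))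
          \<le> (1 - (norm (f u))\<^sup>2) * ((1 - (norm (f z))\<^sup>2) * (norm (1 - cnj u * z))\<^sup>2)"
        using p1 p2 by (simp add: divide_le_eq le_divide_eq mult_ac)
      have "1 - (norm (f u))\<^sup>2 = (1 - norm (f u)) * (1 + norm (f u))"
        by (simp add: power2_eq_square algebra_simps)
      also have "\<dots> \<le> (1 - norm (f u)) * 2" using fu by (intro mult_left_mono) auto
      also have "\<dots> \<le> (b + e) * (1 - norm u) * 2" using le by (intro mult_right_mono) auto
      finally have "(1 - (norm (f u))\<^sup>2) * ((1 - (norm (f z))\<^sup>2) * (norm (1 - cnj u * z))\<^sup>2)
          \<le> (b + e) * (1 - norm u) * 2 * ((1 - (norm (f z))\<^sup>2) * (norm (1 - cnj u * z))\<^sup>2)"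
        using gz by (intro mult_right_mono mult_nonneg_nonneg) auto
      with main have "(norm (1 - cnj (f u) * f z))\<^sup>2 * ((1 - (norm u)\<^sup>2) * (1 - (norm z)\<^sup>2))
          \<le> (b + e) * (1 - norm u) * 2 * ((1 - (norm (f z))\<^sup>2) * (norm (1 - cnj u * z))\<^sup>2)"
        by (rule order_trans)
      moreover have "1 - (norm u)\<^sup>2 = (1 - norm u) * (1 + norm u)"
        by (simp add: power2_eq_square algebra_simps)
      ultimately have "(1 - norm u) * ((norm (1 - cnj (f u) * f z))\<^sup>2 * (1 + norm u) * (1 - (norm z)\<^sup>2))
          \<le> (1 - norm u) * (2 * (b + e) * (norm (1 - cnj u * z))\<^sup>2 * (1 - (norm (f z))\<^sup>2))"
        by (simp only: mult_ac)
      then show ?thesis using u by (simp only: mult_le_cancel_left_pos diff_gt_0_iff_gt)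
    qed
    note approx = this[OF Z(1) gap]
    have "(norm (1 - cnj \<tau> * f z))\<^sup>2 * (1 + norm \<sigma>) * (1 - (norm z)\<^sup>2)
        \<le> 2 * (b + 0) * (norm (1 - cnj \<sigma> * z))\<^sup>2 * (1 - (norm (f z))\<^sup>2)"
    proof (rule LIMSEQ_le)
      show "(\<lambda>n. (norm (1 - cnj (f (Z (r n))) * f z))\<^sup>2 * (1 + norm (Z (r n))) * (1 - (norm z)\<^sup>2))
          \<longlonglongrightarrow> (norm (1 - cnj \<tau> * f z))\<^sup>2 * (1 + norm \<sigma>) * (1 - (norm z)\<^sup>2)"
        by (intro tendsto_intros flim zlim)
      show "(\<lambda>n. 2 * (b + 1 / real (Suc (r n))) * (norm (1 - cnj (Z (r n)) * z))\<^sup>2 * (1 - (norm (f z))\<^sup>2))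
          \<longlonglongrightarrow> 2 * (b + 0) * (norm (1 - cnj \<sigma> * z))\<^sup>2 * (1 - (norm (f z))\<^sup>2)"
        by (intro tendsto_intros zlim elim)
    qed (use approx in blast)
    then show ?thesis
      using \<sigma> by (simp add: norm_one_minus_cnj_mult_unimodular[OF \<tau>] norm_one_minus_cnj_mult_unimodular[OF \<sigma>])
  qed
  with \<tau> show ?thesis by blast
qed

text \<open>Julia's inequality at the origin bounds \<open>b\<close> below by a positive number, since \<open>|f 0| < 1 = |\<tau>|\<close>.\<close>

lemma Julia_imp_dilation_pos:
  assumes im: "f ` \<D> \<subseteq> \<D>" and \<sigma>: "norm \<sigma> = 1" and \<tau>: "norm \<tau> = 1"
    and J: "\<forall>z\<in>\<D>. (norm (\<tau> - f z))\<^sup>2 * (1 - (norm z)\<^sup>2) \<le> b * (norm (\<sigma> - z))\<^sup>2 * (1 - (norm (f z))\<^sup>2)"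
  shows "b > 0"
proof -
  have f0: "norm (f 0) < 1" using im by (auto simp: image_subset_iff)
  then have "\<tau> \<noteq> f 0" using \<tau> by auto
  then have "0 < (norm (\<tau> - f 0))\<^sup>2" by simp
  also have "\<dots> \<le> b * (1 - (norm (f 0))\<^sup>2)" using J[rule_format, of 0] \<sigma> by simp
  finally show ?thesis
    by (rule zero_less_mult_pos2) (use f0 in \<open>intro one_minus_square_pos norm_ge_zero\<close>)
qed

text \<open>In a Stolz region \<open>|\<sigma> - z|\<^sup>2\<close> is at most \<open>M\<^sup>2 (1 - |z|)\<^sup>2\<close>, so one factor \<open>1 - |z|\<close> is left over in
  Julia's inequality and drives \<open>f z - \<tau>\<close> to zero.\<close>

lemma Julia_imp_nontangential_limit:
  assumes im: "f ` \<D> \<subseteq> \<D>" and \<sigma>: "norm \<sigma> = 1" and b: "b > 0"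
    and J: "\<forall>z\<in>\<D>. (norm (\<tau> - f z))\<^sup>2 * (1 - (norm z)\<^sup>2) \<le> b * (norm (\<sigma> - z))\<^sup>2 * (1 - (norm (f z))\<^sup>2)"
  shows "has_nontangential_limit f \<sigma> \<tau>"
  unfolding has_nontangential_limit_def
proof (intro allI impI)
  fix M :: real assume M: "M > 1"
  let ?F = "at \<sigma> within stolz_region \<sigma> M"
  have bound: "(norm (f z - \<tau>))\<^sup>2 \<le> b * M\<^sup>2 * (1 - norm z)" if "z \<in> stolz_region \<sigma> M" for z
  proof -
    have z: "norm z < 1" "norm (\<sigma> - z) \<le> M * (1 - norm z)" using that by (auto simp: stolz_region_def)
    have "norm (f z) < 1" using im z by (auto simp: image_subset_iff)
    then have g: "0 \<le> 1 - (norm (f z))\<^sup>2" "1 - (norm (f z))\<^sup>2 \<le> 1"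
      using one_minus_square_pos[of "norm (f z)"] by auto
    have "(norm (\<tau> - f z))\<^sup>2 * (1 - norm z) = (norm (\<tau> - f z))\<^sup>2 * ((1 - norm z) * 1)" by simp
    also have "\<dots> \<le> (norm (\<tau> - f z))\<^sup>2 * ((1 - norm z) * (1 + norm z))"
      using z by (intro mult_left_mono) auto
    also have "\<dots> = (norm (\<tau> - f z))\<^sup>2 * (1 - (norm z)\<^sup>2)"
      by (simp add: power2_eq_square algebra_simps)
    also have "\<dots> \<le> b * (norm (\<sigma> - z))\<^sup>2 * (1 - (norm (f z))\<^sup>2)" using z by (intro J[rule_format]) simp
    also have "\<dots> \<le> b * (M * (1 - norm z))\<^sup>2 * 1"
    proof (rule mult_mono)
      show "b * (norm (\<sigma> - z))\<^sup>2 \<le> b * (M * (1 - norm z))\<^sup>2"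
        using b z by (intro mult_left_mono power_mono) auto
    qed (use b g in auto)
    also have "\<dots> = b * M\<^sup>2 * (1 - norm z) * (1 - norm z)" by algebra
    finally have "(norm (\<tau> - f z))\<^sup>2 \<le> b * M\<^sup>2 * (1 - norm z)"
      by (rule mult_right_le_imp_le) (use z in simp)
    then show ?thesis by (simp only: norm_minus_commute)
  qed
  have "((\<lambda>z. b * M\<^sup>2 * (1 - norm z)) \<longlongrightarrow> b * M\<^sup>2 * (1 - norm \<sigma>)) ?F"
    by (intro tendsto_intros)
  moreover have "b * M\<^sup>2 * (1 - norm \<sigma>) = 0" using \<sigma> by simp
  ultimately have upper: "((\<lambda>z. b * M\<^sup>2 * (1 - norm z)) \<longlongrightarrow> 0) ?F" by (simp only:)
  have "((\<lambda>z. (norm (f z - \<tau>))\<^sup>2) \<longlongrightarrow> 0) ?F"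
  proof (rule tendsto_sandwich[OF _ _ tendsto_const upper])
    show "\<forall>\<^sub>F z in ?F. (norm (f z - \<tau>))\<^sup>2 \<le> b * M\<^sup>2 * (1 - norm z)"
      unfolding eventually_at_filter using bound by (intro always_eventually) blast
  qed (intro always_eventually allI zero_le_power2)
  then have "((\<lambda>z. sqrt ((norm (f z - \<tau>))\<^sup>2)) \<longlongrightarrow> sqrt 0) ?F" by (rule tendsto_real_sqrt)
  then have "((\<lambda>z. f z - \<tau>) \<longlongrightarrow> 0) ?F"
    by (simp add: tendsto_norm_zero_iff)
  then show "(f \<longlongrightarrow> \<tau>) ?F" by (rule LIM_zero_cancel)
qed

lemma eventually_at_left_1: "\<forall>\<^sub>F r in at_left (1::real). 0 < r \<and> r < 1"
  by (intro eventually_at_leftI[of 0]) auto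

lemma filterlim_radius_stolz:
  assumes \<sigma>: "norm \<sigma> = 1" and M: "M > 1"
  shows "filterlim (\<lambda>r. of_real r * \<sigma>) (at \<sigma> within stolz_region \<sigma> M) (at_left 1)"
  unfolding filterlim_at
proof (rule conjI)
  have "((\<lambda>r::real. of_real r * \<sigma>) \<longlongrightarrow> of_real 1 * \<sigma>) (at_left 1)" by (intro tendsto_intros)
  then show "((\<lambda>r::real. of_real r * \<sigma>) \<longlongrightarrow> \<sigma>) (at_left 1)" by simp
  show "\<forall>\<^sub>F r in at_left 1. of_real r * \<sigma> \<in> stolz_region \<sigma> M \<and> of_real r * \<sigma> \<noteq> \<sigma>"
    using eventually_at_left_1
  proof eventually_elim
    case (elim r)
    have "\<sigma> - of_real r * \<sigma> = of_real (1 - r) * \<sigma>" by (simp add: algebra_simps)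
    then have d: "norm (\<sigma> - of_real r * \<sigma>) = 1 - r" using \<sigma> elim by (simp add: norm_mult del: of_real_diff)
    moreover have "norm (of_real r * \<sigma>) = r" using \<sigma> elim by (simp add: norm_mult)
    ultimately show ?case using elim M by (auto simp: stolz_region_def)
  qed
qed

lemma filterlim_radius_disc:
  assumes \<sigma>: "norm \<sigma> = 1"
  shows "filterlim (\<lambda>r. of_real r * \<sigma>) (at \<sigma> within \<D>) (at_left 1)"
proof -
  have "stolz_region \<sigma> 2 \<subseteq> \<D>" by (auto simp: stolz_region_def)
  then have "at \<sigma> within stolz_region \<sigma> 2 \<le> at \<sigma> within \<D>" by (rule at_le)
  from filterlim_mono[OF filterlim_radius_stolz[OF \<sigma>] this order_refl] show ?thesis by simp
qed

lemma boundary_dilation_nonneg: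
  assumes "\<And>z. z \<in> \<D> \<Longrightarrow> norm (g z) \<le> 1"
  shows "0 \<le> boundary_dilation g \<sigma>"
  unfolding boundary_dilation_def
proof (rule Liminf_bounded)
  show "\<forall>\<^sub>F z in at \<sigma> within \<D>. 0 \<le> ereal ((1 - norm (g z)) / (1 - norm z))"
    unfolding eventually_at_filter using assms by (intro always_eventually) auto
qed

text \<open>On the radius \<open>|\<sigma> - z| = 1 - |z|\<close>, and \<open>|\<tau> - f z| \<ge> 1 - |f z|\<close>. Julia's inequality then bounds
  \<open>(1 - |f z|) / (1 - |z|)\<close> above by a quantity tending to \<open>b\<close>, while \<open>b\<close> is its lower limit by
  definition. The quotient with squared moduli has the same limit and is the one that the automorphism
  identity produces.\<close>

lemma radial_dilation_limit:
  assumes im: "f ` \<D> \<subseteq> \<D>" and \<sigma>: "norm \<sigma> = 1" and \<tau>: "norm \<tau> = 1"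
    and b: "boundary_dilation f \<sigma> = ereal b"
    and J: "\<forall>z\<in>\<D>. (norm (\<tau> - f z))\<^sup>2 * (1 - (norm z)\<^sup>2) \<le> b * (norm (\<sigma> - z))\<^sup>2 * (1 - (norm (f z))\<^sup>2)"
    and lim: "((\<lambda>r. f (of_real r * \<sigma>)) \<longlongrightarrow> \<tau>) (at_left 1)"
  shows "((\<lambda>r. (1 - (norm (f (of_real r * \<sigma>)))\<^sup>2) / (1 - r\<^sup>2)) \<longlongrightarrow> b) (at_left 1)"
proof -
  let ?n = "\<lambda>r::real. norm (f (of_real r * \<sigma>))"
  let ?q = "\<lambda>r::real. (1 - ?n r) / (1 - r)"
  have nlim: "(?n \<longlongrightarrow> 1) (at_left 1)" using tendsto_norm[OF lim] \<tau> by simp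
  have rlim: "((\<lambda>r::real. r) \<longlongrightarrow> 1) (at_left 1)" by (rule tendsto_ident_at)
  have ulim: "((\<lambda>r. b * (1 + ?n r) / (1 + r)) \<longlongrightarrow> b * (1 + 1) / (1 + 1)) (at_left 1)"
    by (intro tendsto_intros nlim rlim) auto
  have upper: "?q r \<le> b * (1 + ?n r) / (1 + r)" if r: "0 < r" "r < 1" for r
  proof -
    let ?z = "of_real r * \<sigma>"
    have nz: "norm ?z = r" using \<sigma> r by (simp add: norm_mult)
    have "\<sigma> - ?z = of_real (1 - r) * \<sigma>" by (simp add: algebra_simps)
    then have d: "norm (\<sigma> - ?z) = 1 - r" using \<sigma> r by (simp add: norm_mult del: of_real_diff)
    have fz: "?n r < 1" using im nz r by (auto simp: image_subset_iff)
    have "(1 - ?n r)\<^sup>2 * (1 - r\<^sup>2) \<le> (norm (\<tau> - f ?z))\<^sup>2 * (1 - r\<^sup>2)"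
      using norm_triangle_ineq2[of \<tau> "f ?z"] \<tau> fz r one_minus_square_pos[of r]
      by (intro mult_right_mono power_mono) auto
    also have "\<dots> \<le> b * (1 - r)\<^sup>2 * (1 - (?n r)\<^sup>2)" using J[rule_format, of ?z] nz d r by simp
    finally have "((1 - ?n r) * (1 - r)) * ((1 - ?n r) * (1 + r))
        \<le> ((1 - ?n r) * (1 - r)) * (b * (1 - r) * (1 + ?n r))"
      by (simp add: power2_eq_square algebra_simps)
    moreover have "(1 - ?n r) * (1 - r) > 0" using fz r by simp
    ultimately have "(1 - ?n r) * (1 + r) \<le> b * (1 - r) * (1 + ?n r)"
      by (simp only: mult_le_cancel_left_pos)
    then show ?thesis using r by (simp add: divide_simps mult_ac)
  qed
  have "(?q \<longlongrightarrow> b) (at_left 1)"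
  proof (rule order_tendstoI)
    fix c assume "c < b"
    then have "ereal c < Liminf (at \<sigma> within \<D>) (\<lambda>z. ereal ((1 - norm (f z)) / (1 - norm z)))"
      using b by (simp add: boundary_dilation_def)
    then have "\<forall>\<^sub>F z in at \<sigma> within \<D>. ereal c < ereal ((1 - norm (f z)) / (1 - norm z))"
      by (rule less_LiminfD)
    from filterlim_radius_disc[OF \<sigma>, unfolded filterlim_iff, rule_format, OF this] eventually_at_left_1
    show "\<forall>\<^sub>F r in at_left 1. c < ?q r"
      by eventually_elim (use \<sigma> in \<open>simp add: norm_mult\<close>)
  next
    fix c assume "b < c"
    then have "\<forall>\<^sub>F r in at_left 1. b * (1 + ?n r) / (1 + r) < c"
      using ulim by (intro order_tendstoD(2)) auto
    with eventually_at_left_1 show "\<forall>\<^sub>F r in at_left 1. ?q r < c"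
      by eventually_elim (use upper in force)
  qed
  then have "((\<lambda>r. ?q r * (1 + ?n r) / (1 + r)) \<longlongrightarrow> b * (1 + 1) / (1 + 1)) (at_left 1)"
    by (intro tendsto_intros nlim rlim) auto
  then have "((\<lambda>r. ?q r * (1 + ?n r) / (1 + r)) \<longlongrightarrow> b) (at_left 1)" by simp
  moreover have "\<forall>\<^sub>F r in at_left 1. ?q r * (1 + ?n r) / (1 + r) = (1 - (?n r)\<^sup>2) / (1 - r\<^sup>2)"
    using eventually_at_left_1
  proof eventually_elim
    case (elim r)
    have "1 - (?n r)\<^sup>2 = (1 - ?n r) * (1 + ?n r)" "1 - r\<^sup>2 = (1 - r) * (1 + r)"
      by (simp_all add: power2_eq_square algebra_simps)
    then show ?case by simp
  qed
  ultimately show ?thesis by (rule Lim_transform_eventually)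
qed

lemma Julia_Caratheodory:
  assumes hol: "f holomorphic_on \<D>" and im: "f ` \<D> \<subseteq> \<D>"
    and \<sigma>: "norm \<sigma> = 1" and b: "boundary_dilation f \<sigma> = ereal b"
  obtains "b > 0" "norm (nontangential_limit f \<sigma>) = 1"
    "((\<lambda>r. f (of_real r * \<sigma>)) \<longlongrightarrow> nontangential_limit f \<sigma>) (at_left 1)"
    "((\<lambda>r. (1 - (norm (f (of_real r * \<sigma>)))\<^sup>2) / (1 - r\<^sup>2)) \<longlongrightarrow> b) (at_left 1)"
proof -
  obtain \<tau> where \<tau>: "norm \<tau> = 1"
    and J: "\<forall>z\<in>\<D>. (norm (\<tau> - f z))\<^sup>2 * (1 - (norm z)\<^sup>2) \<le> b * (norm (\<sigma> - z))\<^sup>2 * (1 - (norm (f z))\<^sup>2)"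
    using Julia_inequality[OF hol im \<sigma> b] by blast
  note pos = Julia_imp_dilation_pos[OF im \<sigma> \<tau> J]
  note nt = Julia_imp_nontangential_limit[OF im \<sigma> pos J]
  have "(f \<longlongrightarrow> \<tau>) (at \<sigma> within stolz_region \<sigma> 2)" using nt by (simp add: has_nontangential_limit_def)
  then have lim: "((\<lambda>r. f (of_real r * \<sigma>)) \<longlongrightarrow> \<tau>) (at_left 1)"
    by (rule filterlim_compose) (rule filterlim_radius_stolz[OF \<sigma>], simp)
  have "nontangential_limit f \<sigma> = \<tau>" by (rule nontangential_limit_eq[OF \<sigma> nt])
  then show ?thesis
    using that pos \<tau> lim radial_dilation_limit[OF im \<sigma> \<tau> b J lim] by simp
qed

section \<open>The recursion for the boundary dilation\<close>

lemma boundary_dilation_unimodular_constant: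
  assumes \<sigma>: "norm \<sigma> = 1" and g: "is_blaschke_product 0 g"
  shows "boundary_dilation g \<sigma> = 0"
proof -
  have "\<forall>\<^sub>F z in at \<sigma> within \<D>. ereal ((1 - norm (g z)) / (1 - norm z)) = 0"
    using g unfolding is_blaschke_product_0_iff eventually_at_filter
    by (intro always_eventually) auto
  then have "boundary_dilation g \<sigma> = Liminf (at \<sigma> within \<D>) (\<lambda>_. 0)"
    unfolding boundary_dilation_def by (rule Liminf_eq)
  moreover have "at \<sigma> within \<D> \<noteq> bot"
  proof
    assume bot: "at \<sigma> within \<D> = bot"
    have "stolz_region \<sigma> 2 \<subseteq> \<D>" by (auto simp: stolz_region_def)
    then have "at \<sigma> within stolz_region \<sigma> 2 = bot" using at_le bot by (metis bot_unique)
    then show False using stolz_region_nontrivial[OF \<sigma>, of 2] by simp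
  qed
  ultimately show ?thesis by (simp add: Liminf_const)
qed

text \<open>A finite radial limit of the quotient with squared moduli already makes the lower limit finite, and then
  the Julia--Caratheodory theorem identifies the two. This is how finiteness passes from \<open>f\<close> to its
  difference quotients.\<close>

lemma boundary_dilation_eq_radial_limit:
  assumes hol: "g holomorphic_on \<D>" and im: "g ` \<D> \<subseteq> \<D> \<or> is_blaschke_product 0 g"
    and \<sigma>: "norm \<sigma> = 1"
    and lim: "((\<lambda>r. (1 - (norm (g (of_real r * \<sigma>)))\<^sup>2) / (1 - r\<^sup>2)) \<longlongrightarrow> L) (at_left 1)"
  shows "boundary_dilation g \<sigma> = ereal L"
  using im
proof
  assume g: "is_blaschke_product 0 g"
  have "\<forall>\<^sub>F r in at_left 1. (1 - (norm (g (of_real r * \<sigma>)))\<^sup>2) / (1 - r\<^sup>2) = 0"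
    using eventually_at_left_1
  proof eventually_elim
    case (elim r)
    then have "norm (g (of_real r * \<sigma>)) = 1"
      using g \<sigma> by (auto simp: is_blaschke_product_0_iff norm_mult)
    then show ?case by simp
  qed
  then have "((\<lambda>r::real. 0) \<longlongrightarrow> L) (at_left 1)" by (rule Lim_transform_eventually[OF lim])
  then have "L = 0" by (simp add: tendsto_const_iff)
  then show ?thesis using boundary_dilation_unimodular_constant[OF \<sigma> g] by simp
next
  assume im: "g ` \<D> \<subseteq> \<D>"
  have gD: "norm (g z) < 1" if "norm z < 1" for z using im that by (auto simp: image_subset_iff)
  have "boundary_dilation g \<sigma> \<noteq> \<infinity>"
  proof
    assume "boundary_dilation g \<sigma> = \<infinity>"
    then have "ereal (2 * (L + 1)) < Liminf (at \<sigma> within \<D>) (\<lambda>z. ereal ((1 - norm (g z)) / (1 - norm z)))"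
      by (simp add: boundary_dilation_def)
    then have "\<forall>\<^sub>F z in at \<sigma> within \<D>. ereal (2 * (L + 1)) < ereal ((1 - norm (g z)) / (1 - norm z))"
      by (rule less_LiminfD)
    note ev1 = filterlim_radius_disc[OF \<sigma>, unfolded filterlim_iff, rule_format, OF this]
    have ev2: "\<forall>\<^sub>F r in at_left 1. (1 - (norm (g (of_real r * \<sigma>)))\<^sup>2) / (1 - r\<^sup>2) < L + 1"
      using lim by (rule order_tendstoD) simp
    have "\<forall>\<^sub>F r in at_left (1::real). False"
      using ev1 ev2 eventually_at_left_1
    proof eventually_elim
      case (elim r)
      let ?n = "norm (g (of_real r * \<sigma>))"
      have nz: "norm (of_real r * \<sigma>) = r" using \<sigma> elim by (simp add: norm_mult)
      have n: "?n < 1" using gD nz elim by simp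
      have "(1 - ?n) / (1 - r) = (1 - ?n) * (1 + r) / (1 - r\<^sup>2)"
      proof -
        have "1 - r\<^sup>2 = (1 - r) * (1 + r)" by (simp add: power2_eq_square algebra_simps)
        then show ?thesis using elim by simp
      qed
      also have "\<dots> \<le> (1 - ?n) * ((1 + ?n) * 2) / (1 - r\<^sup>2)"
      proof (intro divide_right_mono mult_left_mono)
        have "1 + r \<le> 1 * 2" using elim by simp
        also have "\<dots> \<le> (1 + ?n) * 2" by (intro mult_right_mono) auto
        finally show "1 + r \<le> (1 + ?n) * 2" .
      qed (use n elim one_minus_square_pos[of r] in auto)
      also have "\<dots> = 2 * ((1 - ?n\<^sup>2) / (1 - r\<^sup>2))"
        by (simp add: power2_eq_square algebra_simps)
      also have "\<dots> < 2 * (L + 1)" using elim by (intro mult_strict_left_mono) auto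
      finally show False using elim nz by simp
    qed
    then show False by simp
  qed
  moreover have "0 \<le> boundary_dilation g \<sigma>"
    by (rule boundary_dilation_nonneg) (use gD in \<open>auto intro: less_imp_le\<close>)
  ultimately obtain c where c: "boundary_dilation g \<sigma> = ereal c"
    by (cases "boundary_dilation g \<sigma>") auto
  from Julia_Caratheodory[OF hol im \<sigma> c]
  have "((\<lambda>r. (1 - (norm (g (of_real r * \<sigma>)))\<^sup>2) / (1 - r\<^sup>2)) \<longlongrightarrow> c) (at_left 1)" by blast
  then have "c = L" using lim tendsto_unique trivial_limit_at_left_real by blast
  then show ?thesis using c by simp
qed

text \<open>The recursion. With \<open>g = \<Delta>\<^sub>w f\<close>, taking squared moduli in \<open>\<phi>\<^bsub>f(w)\<^esub> \<circ> f = \<phi>\<^sub>w * g\<close> gives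
  \<open>1 - |\<phi>\<^bsub>f(w)\<^esub>(f z)|\<^sup>2 = (1 - |\<phi>\<^sub>w(z)|\<^sup>2) + |\<phi>\<^sub>w(z)|\<^sup>2 (1 - |g z|\<^sup>2)\<close>. After division by
  \<open>1 - |z|\<^sup>2\<close>, all terms except the last are known to converge along the radius, so the last one does too,
  and \<open>|\<phi>\<^sub>w(\<sigma>)| = 1\<close>.\<close>

lemma boundary_dilation_hyp_quotient:
  assumes hol: "f holomorphic_on \<D>" and im: "f ` \<D> \<subseteq> \<D>" and w: "w \<in> \<D>"
    and \<sigma>: "norm \<sigma> = 1" and b: "boundary_dilation f \<sigma> = ereal b"
  defines "a \<equiv> (norm (nontangential_limit f \<sigma> - f w))\<^sup>2 / (1 - (norm (f w))\<^sup>2)"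
  shows "a > 0"
    and "\<exists>c. boundary_dilation (hyp_diff_quotient w f) \<sigma> = ereal c \<and>
         b = a * ((1 - (norm w)\<^sup>2) / (norm (\<sigma> - w))\<^sup>2 + c)"
proof -
  let ?g = "hyp_diff_quotient w f"
  define \<tau> where "\<tau> = nontangential_limit f \<sigma>"
  obtain \<tau>: "norm \<tau> = 1" and flim: "((\<lambda>r. f (of_real r * \<sigma>)) \<longlongrightarrow> \<tau>) (at_left 1)"
    and qlim: "((\<lambda>r. (1 - (norm (f (of_real r * \<sigma>)))\<^sup>2) / (1 - r\<^sup>2)) \<longlongrightarrow> b) (at_left 1)"
    using Julia_Caratheodory[OF hol im \<sigma> b] unfolding \<tau>_def by blast
  have nw: "norm w < 1" using w by simp
  have fw: "norm (f w) < 1" using im w by (auto simp: image_subset_iff)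
  have P: "1 - (norm (f w))\<^sup>2 > 0" using fw by (intro one_minus_square_pos) auto
  have dt: "norm (\<tau> - f w) > 0" using \<tau> fw by auto
  have ds: "norm (\<sigma> - w) > 0" using \<sigma> nw by auto
  show "a > 0" using P dt by (simp add: a_def \<tau>_def)
  have swap: "norm (1 - cnj v * u) = norm (u - v)" if "norm u = 1" for u v
    using norm_one_minus_cnj_mult_unimodular[OF that, of v]
    by (metis complex_cnj_cnj complex_cnj_diff complex_cnj_mult complex_cnj_one complex_mod_cnj mult.commute)
  (* L is the recursion solved for the dilation of the quotient; S and m below are the
     terms of the identity, arranged so that S / m is the difference quotient's radial ratio. *)
  define L where "L = (1 - (norm (f w))\<^sup>2) / (norm (\<tau> - f w))\<^sup>2 * b - (1 - (norm w)\<^sup>2) / (norm (\<sigma> - w))\<^sup>2"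
  let ?z = "\<lambda>r::real. of_real r * \<sigma>"
  let ?S = "\<lambda>r. (1 - (norm (f w))\<^sup>2) / (norm (1 - cnj (f w) * f (?z r)))\<^sup>2 * ((1 - (norm (f (?z r)))\<^sup>2) / (1 - r\<^sup>2))
      - (1 - (norm w)\<^sup>2) / (norm (1 - cnj w * ?z r))\<^sup>2"
  let ?m = "\<lambda>r. (norm (?z r - w))\<^sup>2 / (norm (1 - cnj w * ?z r))\<^sup>2"
  have zlim: "(?z \<longlongrightarrow> \<sigma>) (at_left 1)"
    using filterlim_radius_disc[OF \<sigma>] by (simp add: filterlim_at)
  have split_gap: "1 - X = (1 - M) + M * (1 - G)" if "X = M * G" for X M G :: real
    using that by (simp add: algebra_simps)
  have n1: "norm (1 - cnj (f w) * \<tau>) \<noteq> 0" "norm (1 - cnj w * \<sigma>) \<noteq> 0"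
    using swap[OF \<tau>] swap[OF \<sigma>] dt ds by auto
  have "(?S \<longlongrightarrow> (1 - (norm (f w))\<^sup>2) / (norm (1 - cnj (f w) * \<tau>))\<^sup>2 * b
      - (1 - (norm w)\<^sup>2) / (norm (1 - cnj w * \<sigma>))\<^sup>2) (at_left 1)"
    using n1 by (intro tendsto_intros qlim flim zlim) auto
  then have S: "(?S \<longlongrightarrow> L) (at_left 1)" by (simp only: swap[OF \<tau>] swap[OF \<sigma>] L_def)
  have "(?m \<longlongrightarrow> (norm (\<sigma> - w))\<^sup>2 / (norm (1 - cnj w * \<sigma>))\<^sup>2) (at_left 1)"
    using n1 by (intro tendsto_intros zlim) auto
  then have m: "(?m \<longlongrightarrow> 1) (at_left 1)" using ds by (simp add: swap[OF \<sigma>])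
  have "((\<lambda>r. ?S r / ?m r) \<longlongrightarrow> L / 1) (at_left 1)"
    by (intro tendsto_divide S m) simp
  moreover have "\<forall>\<^sub>F r in at_left 1. ?S r / ?m r = (1 - (norm (?g (?z r)))\<^sup>2) / (1 - r\<^sup>2)"
    using eventually_at_left_1 order_tendstoD(1)[OF m zero_less_one]
  proof eventually_elim
    case (elim r)
    let ?u = "?z r"
    have nu: "norm ?u = r" using \<sigma> elim by (simp add: norm_mult)
    then have u: "?u \<in> \<D>" using elim by simp
    have fu: "norm (f ?u) < 1" using im u by (auto simp: image_subset_iff)
    have r2: "1 - r\<^sup>2 > 0" using elim by (intro one_minus_square_pos) auto
    have m_eq: "(norm (moeb w ?u))\<^sup>2 = ?m r"
      by (simp add: Moebius_function_simple norm_divide power_divide)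
    have "(norm (moeb (f w) (f ?u)))\<^sup>2 = ?m r * (norm (?g ?u))\<^sup>2"
      using hyp_quotient_mult_moeb[OF w u, of f] m_eq by (metis norm_mult power_mult_distrib)
    then have "1 - (norm (moeb (f w) (f ?u)))\<^sup>2 = (1 - (norm (moeb w ?u))\<^sup>2) + ?m r * (1 - (norm (?g ?u))\<^sup>2)"
      unfolding m_eq by (rule split_gap)
    then have "(1 - (norm (f w))\<^sup>2) * (1 - (norm (f ?u))\<^sup>2) / (norm (1 - cnj (f w) * f ?u))\<^sup>2
        = (1 - (norm w)\<^sup>2) * (1 - r\<^sup>2) / (norm (1 - cnj w * ?u))\<^sup>2 + ?m r * (1 - (norm (?g ?u))\<^sup>2)"
      using one_minus_norm_moeb_squared[of "f w" "f ?u"] one_minus_norm_moeb_squared[of w ?u] fw nw fu nu elim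
      by simp
    then have "(1 - (norm (f w))\<^sup>2) * (1 - (norm (f ?u))\<^sup>2) / (norm (1 - cnj (f w) * f ?u))\<^sup>2 / (1 - r\<^sup>2)
        = ((1 - (norm w)\<^sup>2) * (1 - r\<^sup>2) / (norm (1 - cnj w * ?u))\<^sup>2 + ?m r * (1 - (norm (?g ?u))\<^sup>2)) / (1 - r\<^sup>2)"
      by simp
    then have "?S r = ?m r * ((1 - (norm (?g ?u))\<^sup>2) / (1 - r\<^sup>2))"
      using r2 by (simp add: add_divide_distrib mult_ac)
    moreover have "?m r \<noteq> 0" using elim(2) by (rule less_imp_neq[symmetric])
    ultimately show ?case by (metis nonzero_mult_div_cancel_left)
  qed
  ultimately have "((\<lambda>r. (1 - (norm (?g (?z r)))\<^sup>2) / (1 - r\<^sup>2)) \<longlongrightarrow> L / 1) (at_left 1)"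
    by (rule Lim_transform_eventually)
  then have "boundary_dilation ?g \<sigma> = ereal L"
    using boundary_dilation_eq_radial_limit[OF hyp_quotient_holomorphic[OF hol im w] hyp_quotient_dichotomy[OF hol im w] \<sigma>]
    by simp
  moreover have "b = a * ((1 - (norm w)\<^sup>2) / (norm (\<sigma> - w))\<^sup>2 + L)"
    using P dt by (simp add: L_def a_def \<tau>_def)
  ultimately show "\<exists>c. boundary_dilation ?g \<sigma> = ereal c \<and> b = a * ((1 - (norm w)\<^sup>2) / (norm (\<sigma> - w))\<^sup>2 + c)"
    by blast
qed

lemma boundary_dilation_eq_0_iff:
  assumes hol: "g holomorphic_on \<D>" and im: "g ` \<D> \<subseteq> \<D> \<or> is_blaschke_product 0 g"
    and \<sigma>: "norm \<sigma> = 1" and c: "boundary_dilation g \<sigma> = ereal c"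
  shows "c \<ge> 0" and "c = 0 \<longleftrightarrow> is_blaschke_product 0 g"
proof -
  have "c > 0" if "g ` \<D> \<subseteq> \<D>"
    using Julia_Caratheodory[OF hol that \<sigma> c] by blast
  moreover have "c = 0" if "is_blaschke_product 0 g"
    using boundary_dilation_unimodular_constant[OF \<sigma> that] c by (simp add: zero_ereal_def)
  ultimately show "c \<ge> 0" "c = 0 \<longleftrightarrow> is_blaschke_product 0 g" using im by force+
qed

section \<open>Iteration over the points\<close>

lemma blaschke_iter_hdq_iff:
  assumes "\<And>i. i < h \<Longrightarrow> iter_hdq w i f holomorphic_on \<D> \<and> iter_hdq w i f ` \<D> \<subseteq> \<D>"
    and "\<And>i. i \<in> {1..h} \<Longrightarrow> w i \<in> \<D>"
  shows "is_blaschke_product d (iter_hdq w h f) \<longleftrightarrow> is_blaschke_product (d + h) f"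
  using assms
proof (induction h arbitrary: d)
  case (Suc h)
  have "is_blaschke_product d (iter_hdq w (Suc h) f) \<longleftrightarrow> is_blaschke_product (Suc d) (iter_hdq w h f)"
    using blaschke_hyp_quotient_iff[of "iter_hdq w h f" "w (Suc h)" d] Suc.prems by simp
  also have "\<dots> \<longleftrightarrow> is_blaschke_product (Suc d + h) f" using Suc by simp
  finally show ?case by simp
qed simp

text \<open>If the \<open>h\<close>-th quotient were a unimodular constant, that is a Blaschke product of degree 0, then \<open>f\<close>
  would be a Blaschke product of degree \<open>h \<le> k\<close>.\<close>

lemma iter_hdq_self_map:
  assumes "f holomorphic_on \<D>" "f ` \<D> \<subseteq> \<D>"
    and nb: "\<not> (\<exists>d\<le>k. is_blaschke_product d f)"
    and w: "\<And>i. i \<in> {1..k + 1} \<Longrightarrow> w i \<in> \<D>"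
    and "h \<le> k"
  shows "iter_hdq w h f holomorphic_on \<D> \<and> iter_hdq w h f ` \<D> \<subseteq> \<D>"
  using \<open>h \<le> k\<close>
proof (induction h rule: less_induct)
  case (less h)
  show ?case
  proof (cases h)
    case 0
    then show ?thesis using assms by simp
  next
    case (Suc m)
    then have m: "iter_hdq w m f holomorphic_on \<D>" "iter_hdq w m f ` \<D> \<subseteq> \<D>" "w (Suc m) \<in> \<D>"
      using less w by auto
    have "\<not> is_blaschke_product 0 (iter_hdq w h f)"
      using blaschke_iter_hdq_iff[of h w f 0] less w nb by auto
    then show ?thesis
      using hyp_quotient_holomorphic[OF m] hyp_quotient_dichotomy[OF m] Suc by simp
  qed
qed

text \<open>Each use of the recursion splits the remainder \<open>c\<close> into the next term of the sum and the dilation of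
  the next quotient, both multiplied by one more factor \<open>a n\<close>.\<close>

lemma boundary_dilation_expansion:
  assumes \<sigma>: "norm \<sigma> = 1" and b: "boundary_dilation f \<sigma> = ereal b"
    and "\<And>i. i < n \<Longrightarrow> iter_hdq w i f holomorphic_on \<D> \<and> iter_hdq w i f ` \<D> \<subseteq> \<D>"
    and "\<And>i. i \<in> {1..n} \<Longrightarrow> w i \<in> \<D>"
  defines "a \<equiv> \<lambda>h. (norm (nontangential_limit (iter_hdq w h f) \<sigma> - iter_hdq w h f (w (h+1))))\<^sup>2 /
           (1 - (norm (iter_hdq w h f (w (h+1))))\<^sup>2)"
  shows "(\<Prod>h<n. a h) > 0 \<and> (\<exists>c. boundary_dilation (iter_hdq w n f) \<sigma> = ereal c \<and>
     b = (\<Sum>j<n. (1 - (norm (w (j+1)))\<^sup>2) / (norm (\<sigma> - w (j+1)))\<^sup>2 * (\<Prod>h=0..j. a h)) + (\<Prod>h<n. a h) * c)"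
  using assms(3,4)
proof (induction n)
  case 0
  then show ?case using b by simp
next
  case (Suc n)
  let ?g = "iter_hdq w n f"
  let ?P = "\<lambda>j. (1 - (norm (w (j+1)))\<^sup>2) / (norm (\<sigma> - w (j+1)))\<^sup>2"
  obtain c where pos: "(\<Prod>h<n. a h) > 0" and c: "boundary_dilation ?g \<sigma> = ereal c"
    and eq: "b = (\<Sum>j<n. ?P j * (\<Prod>h=0..j. a h)) + (\<Prod>h<n. a h) * c"
    using Suc by auto
  have g: "?g holomorphic_on \<D>" "?g ` \<D> \<subseteq> \<D>" "w (Suc n) \<in> \<D>" using Suc.prems by auto
  have an: "a n > 0"
    using boundary_dilation_hyp_quotient(1)[OF g \<sigma> c] by (simp add: a_def)
  obtain c' where c': "boundary_dilation (iter_hdq w (Suc n) f) \<sigma> = ereal c'" and cc: "c = a n * (?P n + c')"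
    using boundary_dilation_hyp_quotient(2)[OF g \<sigma> c] by (auto simp: a_def)
  have "(\<Prod>h=0..n. a h) = (\<Prod>h<n. a h) * a n"
    by (simp add: lessThan_Suc_atMost[symmetric] atLeast0AtMost mult.commute)
  then have "b = (\<Sum>j<Suc n. ?P j * (\<Prod>h=0..j. a h)) + (\<Prod>h<Suc n. a h) * c'"
    unfolding eq cc by (simp add: algebra_simps)
  then show ?case using c' pos an by auto
qed

theorem theorem1p6:
  fixes k :: nat and f :: "complex \<Rightarrow> complex" and \<sigma> :: complex
  assumes "f holomorphic_on \<D>"
    and "f ` \<D> \<subseteq> \<D>"
    and "\<not> (\<exists>d\<le>k. is_blaschke_product d f)"
    and "norm \<sigma> = 1"
    and "boundary_dilation f \<sigma> < \<infinity>"
  shows "(\<forall>w :: nat \<Rightarrow> complex. (\<forall>i\<in>{1..k+1}. w i \<in> \<D>) \<longrightarrow>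
            boundary_dilation f \<sigma> \<ge> ereal (boundary_sum f \<sigma> k w)) \<and>
         ((\<exists>w :: nat \<Rightarrow> complex. (\<forall>i\<in>{1..k+1}. w i \<in> \<D>) \<and>
            boundary_dilation f \<sigma> = ereal (boundary_sum f \<sigma> k w)) \<longleftrightarrow>
          (\<forall>w :: nat \<Rightarrow> complex. (\<forall>i\<in>{1..k+1}. w i \<in> \<D>) \<longrightarrow>
            boundary_dilation f \<sigma> = ereal (boundary_sum f \<sigma> k w))) \<and>
         ((\<forall>w :: nat \<Rightarrow> complex. (\<forall>i\<in>{1..k+1}. w i \<in> \<D>) \<longrightarrow>
            boundary_dilation f \<sigma> = ereal (boundary_sum f \<sigma> k w)) \<longleftrightarrow>
          is_blaschke_product (k+1) f)"
proof -
  note hol = assms(1) and im = assms(2) and nb = assms(3) and \<sigma> = assms(4)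
  have "0 \<le> boundary_dilation f \<sigma>"
    by (rule boundary_dilation_nonneg) (use im in \<open>force simp: image_subset_iff\<close>)
  then obtain b where b: "boundary_dilation f \<sigma> = ereal b"
    using assms(5) by (cases "boundary_dilation f \<sigma>") auto
  have key: "boundary_sum f \<sigma> k w \<le> b \<and> (b = boundary_sum f \<sigma> k w \<longleftrightarrow> is_blaschke_product (k+1) f)"
    if "\<forall>i\<in>{1..k+1}. w i \<in> \<D>" for w
  proof -
    have w: "\<And>i. i \<in> {1..k+1} \<Longrightarrow> w i \<in> \<D>" using that by blast
    have self: "iter_hdq w i f holomorphic_on \<D> \<and> iter_hdq w i f ` \<D> \<subseteq> \<D>" if "i < k + 1" for i
      using iter_hdq_self_map[OF hol im nb w] that by simp
    obtain p c where p: "p > 0" and c: "boundary_dilation (iter_hdq w (k+1) f) \<sigma> = ereal c"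
      and eq: "b = boundary_sum f \<sigma> k w + p * c"
      using boundary_dilation_expansion[OF \<sigma> b self w]
      unfolding boundary_sum_def atLeast0AtMost[of k] lessThan_Suc_atMost[symmetric] Suc_eq_plus1 by blast
    have g: "iter_hdq w k f holomorphic_on \<D>" "iter_hdq w k f ` \<D> \<subseteq> \<D>" "w (Suc k) \<in> \<D>"
      using self w by auto
    have "c \<ge> 0" "c = 0 \<longleftrightarrow> is_blaschke_product 0 (iter_hdq w (k+1) f)"
      using boundary_dilation_eq_0_iff[OF hyp_quotient_holomorphic[OF g] hyp_quotient_dichotomy[OF g] \<sigma>] c
      by auto
    moreover have "is_blaschke_product 0 (iter_hdq w (k+1) f) \<longleftrightarrow> is_blaschke_product (k+1) f"
      using blaschke_iter_hdq_iff[of "k+1" w f 0, OF self w] by (simp del: iter_hdq.simps)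
    ultimately show ?thesis using eq p by simp
  qed
  have admissible: "\<forall>i\<in>{1..k+1}. (0 :: complex) \<in> \<D>" by simp
  (* Equality at w is equivalent to a condition that does not mention w. Since there is at least one
     admissible w, the existential and the universal statement are therefore both equivalent to it. *)
  have logic: "(\<forall>w. A w \<longrightarrow> T w) \<and> ((\<exists>w. A w \<and> E w) \<longleftrightarrow> (\<forall>w. A w \<longrightarrow> E w)) \<and> ((\<forall>w. A w \<longrightarrow> E w) \<longleftrightarrow> B)"
    if "\<And>w. A w \<Longrightarrow> T w \<and> (E w \<longleftrightarrow> B)" "A w\<^sub>0"
    for A T E :: "(nat \<Rightarrow> complex) \<Rightarrow> bool" and B and w\<^sub>0
    using that by blast
  show ?thesis
    unfolding b ereal_less_eq(3) ereal.inject
    by (rule logic[where A = "\<lambda>w. \<forall>i\<in>{1..k+1}. w i \<in> \<D>", OF key admissible])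
qed

end
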